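(* Let $A = kQ/I$ be a quadratic string algebra and suppose $\mathcal{G}_n \neq \emptyset$ for some $n > 0$. Then the cup product defined in $\mathrm{HH}^{*}(A)$ is non-trivial. More precisely, for any $s_1, s_2 \geq 1$: (i) if $n$ is even and $\operatorname{char} k \neq 2$, then $\mathrm{HH}^{s_1n}(A) \cup \mathrm{HH}^{s_2n}(A) \neq 0$; (ii) if $n$ is odd and $\operatorname{char} k \neq 2$, then $\mathrm{HH}^{2s_1n}(A) \cup \mathrm{HH}^{2s_2n}(A) \neq 0$; (iii) if $\operatorname{char} k = 2$, then $\mathrm{HH}^{s_1n}(A) \cup \mathrm{HH}^{s_2n}(A) \neq 0$.
   Context: Let $k$ be an algebraically closed field and $Q=(Q_0,Q_1,s,t)$ a finite connected quiver. Paths are written $\alpha_1\cdots\alpha_l$ with $t(\alpha_i)=s(\alpha_{i+1})$; $e_x$ is the trivial path at a vertex $x$. For arrows $\alpha,\beta$, "$\alpha\beta\in I$" (resp. "$\alpha\beta\notin I$") means $t(\alpha)=s(\beta)$ and the path $\alpha\beta$ lies (resp. does not lie) in $I$. A quadratic string algebra is $A=kQ/I$ where $I$ is an admissible ideal of $kQ$ ($F^m\subseteq I\subseteq F^2$ for some $m\ge 2$, $F$ the arrow ideal) generated by paths of length two, such that: (S1) each vertex is the source of at most two arrows and the target of at most two arrows; (S2) for each arrow $\alpha$ there is at most one arrow $\beta$ with $\alpha\beta\notin I$ and at most one arrow $\gamma$ with $\gamma\alpha\notin I$. Let $\mathcal{C}_n$ ($n\ge1$) be the set of pairs $(\alpha_1\cdots\alpha_n,e_{s(\alpha_1)})$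 where $\alpha_1\cdots\alpha_n$ is an oriented cycle of $n$ arrows with $\alpha_i\alpha_{i+1}\in I$ for $1\le i<n$ and $\alpha_n\alpha_1\in I$. Put $\tau(\alpha_1\cdots\alpha_n,e_{s(\alpha_1)})=(\alpha_n\alpha_1\cdots\alpha_{n-1},e_{s(\alpha_n)})$. $\mathcal{C}_n(0)$ is the set of those pairs in $\mathcal{C}_n$ for which there is no arrow $\gamma\neq\alpha_n$ with $\gamma\alpha_1\in I$ and no arrow $\beta\ne\alpha_1$ with $\alpha_n\beta\in I$. $\mathcal{G}_n$ (gentle pairs) is the set of $w\in\mathcal{C}_n$ with $\tau^m(w)\in\mathcal{C}_n(0)$ for all $m\in\mathbb{Z}$. $\mathrm{HH}^n(A)=\mathrm{Ext}^n_{A-A}(A,A)$ and $\mathrm{HH}^*(A)=\bigoplus_{n\ge0}\mathrm{HH}^n(A)$. With $E=kQ_0$ and tensor products over $E$, the bar complex has cochains $\mathrm{Hom}_{E-E}(A^{\otimes n},A)$, and the cup product is induced by $(f\cup g)(v_1\otimes\cdots\otimes v_{n+m})=f(v_1\otimes\cdots\otimes v_n)\,g(v_{n+1}\otimes\cdots\otimes v_{n+m})$ for $f\in \mathrm{Hom}_{E-E}(A^{\otimes n},A)$, $g\in \mathrm{Hom}_{E-E}(A^{\otimes m},A)$. "$\mathrm{HH}^a(A)\cup\mathrm{HH}^b(A)\ne0$" means there are $u\in\mathrm{HH}^a(A)$, $v\in\mathrm{HH}^b(A)$ with $u\cup v\neq0$. *)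

theory Defs
  imports
    "HOL-Computational_Algebra.Polynomial"
    "Graph_Theory.Arc_Walk"
    "Graph_Theory.Digraph_Component"
    "HOL-Algebra.QuotRing"
    "HOL-Algebra.Ideal_Product"
begin

section \<open>Quivers and path algebras\<close>

text \<open>
  A quiver is a digraph of Graph_Theory (loops and parallel arcs are allowed there), with
  \<open>verts\<close>, \<open>arcs\<close>, \<open>tail\<close>, \<open>head\<close> in the roles of \<open>Q\<^sub>0\<close>, \<open>Q\<^sub>1\<close>, \<open>s\<close>, \<open>t\<close>.
  A path is a pair of its source vertex and its list of arrows; \<open>(x, [])\<close> is the trivial
  path at \<open>x\<close>.
\<close>

type_synonym ('v, 'e) qpath = "'v \<times> 'e list"

definition qpaths :: "('v, 'e) pre_digraph \<Rightarrow> ('v, 'e) qpath set" where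
  "qpaths Q = {(u, p). \<exists>v. pre_digraph.awalk Q u p v}"

abbreviation ptarget :: "('v, 'e) pre_digraph \<Rightarrow> 'v \<Rightarrow> 'e list \<Rightarrow> 'v" where
  "ptarget Q u p \<equiv> pre_digraph.awlast Q u p"

text \<open>
  Elements of \<open>kQ\<close> are finitely supported coefficient functions on paths. The coefficient of
  a product at a path is the convolution over all ways to cut that path in two.
\<close>

definition path_algebra ::
    "('v, 'e) pre_digraph \<Rightarrow> (('v, 'e) qpath \<Rightarrow> 'k :: field) ring" where
  "path_algebra Q =
    \<lparr> carrier = {f. finite {x. f x \<noteq> 0} \<and> {x. f x \<noteq> 0} \<subseteq> qpaths Q},
      mult = (\<lambda>f g (u, p). if (u, p) \<in> qpaths Q
                then \<Sum>i\<le>length p. f (u, take i p) * g (ptarget Q u (take i p), drop i p)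
                else 0),
      one = (\<lambda>(u, p). if u \<in> verts Q \<and> p = [] then 1 else 0),
      zero = (\<lambda>_. 0),
      add = (\<lambda>f g x. f x + g x) \<rparr>"

definition path_elem :: "('v, 'e) qpath \<Rightarrow> ('v, 'e) qpath \<Rightarrow> 'k :: field" where
  "path_elem x = (\<lambda>y. if y = x then 1 else 0)"

lemma qpaths_split:
  assumes "wf_digraph Q"
  shows "(u, p) \<in> qpaths Q \<longleftrightarrow> (u, take i p) \<in> qpaths Q \<and> (ptarget Q u (take i p), drop i p) \<in> qpaths Q"
proof -
  interpret wf_digraph Q by fact
  have "(\<exists>v. awalk u (take i p @ drop i p) v) \<longleftrightarrow> (\<exists>v. awalk u (take i p) v) \<and> (\<exists>v. awalk (awlast u (take i p)) (drop i p) v)"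
    unfolding awalk_append_iff
    by (metis awlast_if_cas awalk_def)
  then show ?thesis by (simp add: qpaths_def)
qed

lemma ptarget_append:
  "ptarget Q u (p @ q) = ptarget Q (ptarget Q u p) q"
  by (auto simp: pre_digraph.awalk_verts_conv)

lemma path_algebra_simps:
  "carrier (path_algebra Q) = {f. finite {x. f x \<noteq> 0} \<and> {x. f x \<noteq> 0} \<subseteq> qpaths Q}"
  "zero (path_algebra Q) = (\<lambda>_. 0)" "add (path_algebra Q) f g = (\<lambda>x. f x + g x)"
  "one (path_algebra Q) = (\<lambda>(u, p). if u \<in> verts Q \<and> p = [] then 1 else 0)"
  by (auto simp: path_algebra_def)

lemma path_algebra_mult:
  "mult (path_algebra Q) f g (u, p) = (if (u, p) \<in> qpaths Q
                then \<Sum>i\<le>length p. f (u, take i p) * g (ptarget Q u (take i p), drop i p)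
                else 0)"
  by (simp add: path_algebra_def)

lemma sum_triangle_swap: "(\<Sum>i\<le>(n::nat). \<Sum>j\<le>i. F i j) = (\<Sum>j\<le>n. \<Sum>i\<le>n-j. F (j+i) j)" for F :: "_ \<Rightarrow> _ \<Rightarrow> 'a :: comm_monoid_add"
  unfolding sum.Sigma[OF finite_atMost ballI[OF finite_atMost]]
  by (rule sum.reindex_bij_witness[where i = "\<lambda>(j,i). (j+i,j)" and j = "\<lambda>(i,j). (j,i-j)"]) auto

lemma path_algebra_ring:
  assumes "fin_digraph Q"
  shows "ring (path_algebra Q :: (_ \<Rightarrow> 'k :: field) ring)"
proof -
  interpret fin_digraph Q by fact
  note wf = wf_digraph_axioms
  let ?R = "path_algebra Q :: (_ \<Rightarrow> 'k) ring"
  have nz: "f x = 0" if "f \<in> carrier ?R" "x \<notin> qpaths Q" for f x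
    using that by (auto simp: path_algebra_simps)
  have addc: "f \<oplus>\<^bsub>?R\<^esub> g \<in> carrier ?R" if "f \<in> carrier ?R" "g \<in> carrier ?R" for f g
  proof -
    have "{x. f x + g x \<noteq> 0} \<subseteq> {x. f x \<noteq> 0} \<union> {x. g x \<noteq> 0}" by auto
    with that show ?thesis by (auto simp: path_algebra_simps intro: finite_subset)
  qed
  have negc: "(\<lambda>x. - f x) \<in> carrier ?R" if "f \<in> carrier ?R" for f
    using that by (auto simp: path_algebra_simps)
  have multc: "f \<otimes>\<^bsub>?R\<^esub> g \<in> carrier ?R" if "f \<in> carrier ?R" "g \<in> carrier ?R" for f g
  proof -
    have "{x. (f \<otimes>\<^bsub>?R\<^esub> g) x \<noteq> 0} \<subseteq> (\<lambda>((u,a),(v,b)). (u,a@b)) ` ({x. f x \<noteq> 0} \<times> {x. g x \<noteq> 0})"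
    proof (clarsimp)
      fix u p assume "(f \<otimes>\<^bsub>?R\<^esub> g) (u, p) \<noteq> 0"
      then obtain i where "f (u, take i p) * g (ptarget Q u (take i p), drop i p) \<noteq> 0"
        unfolding path_algebra_mult by (metis (mono_tags, lifting) sum.neutral)
      then show "(u, p) \<in> (\<lambda>((u,a),(v,b)). (u,a@b)) ` ({x. f x \<noteq> 0} \<times> {x. g x \<noteq> 0})"
        by (intro image_eqI[of _ _ "((u, take i p), (ptarget Q u (take i p), drop i p))"]) auto
    qed
    moreover have "finite ((\<lambda>((u,a),(v,b)). (u,a@b)) ` ({x. f x \<noteq> 0} \<times> {x. g x \<noteq> 0}))"
      using that by (intro finite_imageI finite_cartesian_product) (auto simp: path_algebra_simps)
    ultimately have "finite {x. (f \<otimes>\<^bsub>?R\<^esub> g) x \<noteq> 0}" by (rule finite_subset)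
    moreover have "{x. (f \<otimes>\<^bsub>?R\<^esub> g) x \<noteq> 0} \<subseteq> qpaths Q"
      by (auto simp: path_algebra_mult split: if_splits)
    ultimately show ?thesis by (simp add: path_algebra_simps(1))
  qed
  have onec: "\<one>\<^bsub>?R\<^esub> \<in> carrier ?R"
  proof -
    have "{x. \<one>\<^bsub>?R\<^esub> x \<noteq> 0} \<subseteq> (\<lambda>u. (u, [])) ` verts Q" by (auto simp: path_algebra_simps split: if_splits)
    then have "finite {x. \<one>\<^bsub>?R\<^esub> x \<noteq> 0}" by (rule finite_subset) simp
    moreover have "{x. \<one>\<^bsub>?R\<^esub> x \<noteq> 0} \<subseteq> qpaths Q"
      by (auto simp: path_algebra_simps qpaths_def awalk_def split: if_splits)
    ultimately show ?thesis unfolding path_algebra_simps(1) by blast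
  qed
  show ?thesis
  proof (rule ringI)
    show "abelian_group ?R"
    proof (rule abelian_groupI)
      fix x assume "x \<in> carrier ?R"
      then show "\<exists>y\<in>carrier ?R. y \<oplus>\<^bsub>?R\<^esub> x = \<zero>\<^bsub>?R\<^esub>"
        by (intro bexI[OF _ negc]) (auto simp: path_algebra_simps)
    qed (use addc in \<open>auto simp: path_algebra_simps add_ac\<close>)
    show "Group.monoid ?R"
    proof (rule monoidI)
      fix f g h assume c: "f \<in> carrier ?R" "g \<in> carrier ?R" "h \<in> carrier ?R"
      show "f \<otimes>\<^bsub>?R\<^esub> g \<otimes>\<^bsub>?R\<^esub> h = f \<otimes>\<^bsub>?R\<^esub> (g \<otimes>\<^bsub>?R\<^esub> h)"
      proof (rule ext, clarify)
        fix u p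
        show "(f \<otimes>\<^bsub>?R\<^esub> g \<otimes>\<^bsub>?R\<^esub> h) (u, p) = (f \<otimes>\<^bsub>?R\<^esub> (g \<otimes>\<^bsub>?R\<^esub> h)) (u, p)"
        proof (cases "(u, p) \<in> qpaths Q")
          case True
          then have s: "(u, take i p) \<in> qpaths Q" "(ptarget Q u (take i p), drop i p) \<in> qpaths Q" for i
            using qpaths_split[OF wf] by blast+
          have "(f \<otimes>\<^bsub>?R\<^esub> g \<otimes>\<^bsub>?R\<^esub> h) (u, p) = (\<Sum>i\<le>length p. \<Sum>j\<le>i. f (u, take j p) *
             g (ptarget Q u (take j p), drop j (take i p)) * h (ptarget Q u (take i p), drop i p))"
            using True s by (auto simp: path_algebra_mult sum_distrib_right min_def intro!: sum.cong)
          also have "\<dots> = (\<Sum>j\<le>length p. \<Sum>i\<le>length p - j. f (u, take j p) *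
             g (ptarget Q u (take j p), drop j (take (j+i) p)) * h (ptarget Q u (take (j+i) p), drop (j+i) p))"
            by (rule sum_triangle_swap)
          also have "\<dots> = (f \<otimes>\<^bsub>?R\<^esub> (g \<otimes>\<^bsub>?R\<^esub> h)) (u, p)"
            using True s
            by (auto simp: path_algebra_mult sum_distrib_left take_add drop_drop add.commute mult.assoc
                ptarget_append[symmetric] simp flip: take_drop intro!: sum.cong)
          finally show ?thesis .
        qed (simp add: path_algebra_mult)
      qed
    next
      fix f assume c: "f \<in> carrier ?R"
      have v: "u \<in> verts Q" "ptarget Q u p \<in> verts Q" if "(u, p) \<in> qpaths Q" for u p
        using that by (auto simp: qpaths_def awalk_def intro!: awlast_in_verts)
      show "\<one>\<^bsub>?R\<^esub> \<otimes>\<^bsub>?R\<^esub> f = f"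
      proof (rule ext, clarify)
        fix u p
        have "(\<Sum>i\<le>length p. \<one>\<^bsub>?R\<^esub> (u, take i p) * f (ptarget Q u (take i p), drop i p)) = 
           (\<Sum>i\<in>{0}. \<one>\<^bsub>?R\<^esub> (u, take i p) * f (ptarget Q u (take i p), drop i p))"
          by (rule sum.mono_neutral_right) (auto simp: path_algebra_simps)
        then show "(\<one>\<^bsub>?R\<^esub> \<otimes>\<^bsub>?R\<^esub> f) (u, p) = f (u, p)"
          using v[of u p] nz[OF c] by (auto simp: path_algebra_mult) (auto simp: path_algebra_simps)
      qed
      show "f \<otimes>\<^bsub>?R\<^esub> \<one>\<^bsub>?R\<^esub> = f"
      proof (rule ext, clarify)
        fix u p
        have "(\<Sum>i\<le>length p. f (u, take i p) * \<one>\<^bsub>?R\<^esub> (ptarget Q u (take i p), drop i p)) = 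
           (\<Sum>i\<in>{length p}. f (u, take i p) * \<one>\<^bsub>?R\<^esub> (ptarget Q u (take i p), drop i p))"
          by (rule sum.mono_neutral_right) (auto simp: path_algebra_simps)
        then show "(f \<otimes>\<^bsub>?R\<^esub> \<one>\<^bsub>?R\<^esub>) (u, p) = f (u, p)"
          using v[of u p] nz[OF c] by (auto simp: path_algebra_mult) (auto simp: path_algebra_simps)
      qed
    qed (use multc onec in auto)
  next
    fix f g h assume "f \<in> carrier ?R" "g \<in> carrier ?R" "h \<in> carrier ?R"
    show "(f \<oplus>\<^bsub>?R\<^esub> g) \<otimes>\<^bsub>?R\<^esub> h = f \<otimes>\<^bsub>?R\<^esub> h \<oplus>\<^bsub>?R\<^esub> g \<otimes>\<^bsub>?R\<^esub> h"
      by (rule ext, clarify) (auto simp: path_algebra_mult path_algebra_simps(3) distrib_right sum.distrib)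
    show "h \<otimes>\<^bsub>?R\<^esub> (f \<oplus>\<^bsub>?R\<^esub> g) = h \<otimes>\<^bsub>?R\<^esub> f \<oplus>\<^bsub>?R\<^esub> h \<otimes>\<^bsub>?R\<^esub> g"
      by (rule ext, clarify) (auto simp: path_algebra_mult path_algebra_simps(3) distrib_left sum.distrib)
  qed
qed

lemma path_elem_mult:
  fixes Q :: "('v, 'e) pre_digraph"
  assumes "fin_digraph Q" "(u, p) \<in> qpaths Q" "(v, q) \<in> qpaths Q"
  shows "(path_elem (u, p) :: _ \<Rightarrow> 'k :: field) \<otimes>\<^bsub>path_algebra Q\<^esub> path_elem (v, q) =
    (if ptarget Q u p = v then path_elem (u, p @ q) else (\<lambda>_. 0))" (is "?L = ?R")
proof -
  interpret fin_digraph Q by fact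
  show ?thesis
  proof (rule ext, clarify)
    fix w :: 'v and r :: "'e list"
    let ?s = "\<lambda>i. (path_elem (u, p) :: _ \<Rightarrow> 'k) (w, take i r) * (path_elem (v, q) :: _ \<Rightarrow> 'k) (ptarget Q w (take i r), drop i r)"
    have 1: "?s i = (if i = length p then if w = u \<and> r = p @ q \<and> ptarget Q u p = v then 1 else 0 else 0)" 
      if "i \<le> length r" for i
    proof (cases "i = length p \<and> w = u \<and> take i r = p")
      case True
      then have "r = p @ q \<longleftrightarrow> drop i r = q" by (metis append_take_drop_id append_same_eq same_append_eq)
      moreover have "take (length p) r = p" using True by auto
      ultimately show ?thesis using True by (auto simp: path_elem_def)
    next
      case False
      have "\<not> (w = u \<and> take i r = p)" using False that by (metis length_take min.absorb2)
      moreover from this have "path_elem (u, p) (w, take i r) = (0 :: 'k)" by (auto simp: path_elem_def)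
      moreover have "\<not> (i = length p \<and> w = u \<and> r = p @ q)" using False by auto
      ultimately show ?thesis by (simp only: mult_zero_left) presburger
    qed
    have 2: "(u, p @ q) \<in> qpaths Q" if "ptarget Q u p = v"
      using qpaths_split[OF wf_digraph_axioms, of u "p @ q" "length p"] assms that by simp
    have "(\<Sum>i\<le>length r. ?s i) = (if w = u \<and> r = p @ q \<and> ptarget Q u p = v then 1 else 0)"
    proof -
      have "(\<Sum>i\<le>length r. ?s i) = (\<Sum>i\<le>length r. if i = length p then if w = u \<and> r = p @ q \<and> ptarget Q u p = v then 1 else 0 else 0)"
        by (rule sum.cong) (use 1 in auto)
      also have "\<dots> = (if w = u \<and> r = p @ q \<and> ptarget Q u p = v then 1 else 0)"
        by (subst sum.delta) auto
      finally show ?thesis .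
    qed
    then show "?L (w, r) = ?R (w, r)"
      unfolding path_algebra_mult using 2 by (simp only:) (auto simp: path_elem_def)
  qed
qed

definition arrow_ideal ::
    "('v, 'e) pre_digraph \<Rightarrow> (('v, 'e) qpath \<Rightarrow> 'k :: field) set" where
  "arrow_ideal Q = Idl\<^bsub>path_algebra Q\<^esub> {path_elem (tail Q a, [a]) |a. a \<in> arcs Q}"

definition arrow_ideal_pow ::
    "('v, 'e) pre_digraph \<Rightarrow> nat \<Rightarrow> (('v, 'e) qpath \<Rightarrow> 'k :: field) set" where
  "arrow_ideal_pow Q m =
    ((ideal_prod (path_algebra Q) (arrow_ideal Q)) ^^ m) (carrier (path_algebra Q))"

definition admissible_ideal ::
    "('v, 'e) pre_digraph \<Rightarrow> (('v, 'e) qpath \<Rightarrow> 'k :: field) set \<Rightarrow> bool" where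
  "admissible_ideal Q I \<longleftrightarrow> ideal I (path_algebra Q) \<and>
    (\<exists>m\<ge>2. arrow_ideal_pow Q m \<subseteq> I \<and> I \<subseteq> arrow_ideal_pow Q 2)"


section \<open>Quadratic string algebras\<close>

definition arrows_in ::
    "('v, 'e) pre_digraph \<Rightarrow> (('v, 'e) qpath \<Rightarrow> 'k :: field) set \<Rightarrow> 'e \<Rightarrow> 'e \<Rightarrow> bool" where
  "arrows_in Q I a b \<longleftrightarrow> a \<in> arcs Q \<and> b \<in> arcs Q \<and> head Q a = tail Q b \<and>
    path_elem (tail Q a, [a, b]) \<in> I"

definition arrows_notin ::
    "('v, 'e) pre_digraph \<Rightarrow> (('v, 'e) qpath \<Rightarrow> 'k :: field) set \<Rightarrow> 'e \<Rightarrow> 'e \<Rightarrow> bool" where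
  "arrows_notin Q I a b \<longleftrightarrow> a \<in> arcs Q \<and> b \<in> arcs Q \<and> head Q a = tail Q b \<and>
    path_elem (tail Q a, [a, b]) \<notin> I"

definition quadratic_string ::
    "('v, 'e) pre_digraph \<Rightarrow> (('v, 'e) qpath \<Rightarrow> 'k :: field) set \<Rightarrow> bool" where
  "quadratic_string Q I \<longleftrightarrow>
     fin_digraph Q \<and> connected Q \<and> admissible_ideal Q I \<and>
     (\<exists>P. P \<subseteq> {x \<in> qpaths Q. length (snd x) = 2} \<and>
        I = Idl\<^bsub>path_algebra Q\<^esub> (path_elem ` P)) \<and>
     (\<forall>x\<in>verts Q. card {a \<in> arcs Q. tail Q a = x} \<le> 2 \<and>
                   card {a \<in> arcs Q. head Q a = x} \<le> 2) \<and>
     (\<forall>a\<in>arcs Q. card {b. arrows_notin Q I a b} \<le> 1 \<and>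
                  card {c. arrows_notin Q I c a} \<le> 1)"

definition qalgebra ::
    "('v, 'e) pre_digraph \<Rightarrow> (('v, 'e) qpath \<Rightarrow> 'k :: field) set
      \<Rightarrow> (('v, 'e) qpath \<Rightarrow> 'k) set ring" where
  "qalgebra Q I = path_algebra Q Quot I"

text \<open>The subring \<open>E = kQ\<^sub>0\<close>, viewed inside \<open>A = kQ/I\<close>.\<close>

definition vertex_subring ::
    "('v, 'e) pre_digraph \<Rightarrow> (('v, 'e) qpath \<Rightarrow> 'k :: field) set
      \<Rightarrow> (('v, 'e) qpath \<Rightarrow> 'k) set set" where
  "vertex_subring Q I =
    {I +>\<^bsub>path_algebra Q\<^esub> f |f. f \<in> carrier (path_algebra Q) \<and>
        (\<forall>u p. f (u, p) \<noteq> 0 \<longrightarrow> p = [])}"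


section \<open>Gentle pairs\<close>

definition cycle_pairs ::
    "('v, 'e) pre_digraph \<Rightarrow> (('v, 'e) qpath \<Rightarrow> 'k :: field) set \<Rightarrow> nat
      \<Rightarrow> (('v, 'e) qpath \<times> ('v, 'e) qpath) set" where
  "cycle_pairs Q I n =
    {((u, p), (u, [])) |u p. pre_digraph.awalk Q u p u \<and> length p = n \<and> n \<ge> 1 \<and>
        (\<forall>i. Suc i < n \<longrightarrow> arrows_in Q I (p ! i) (p ! Suc i)) \<and>
        arrows_in Q I (last p) (hd p)}"

definition tau ::
    "('v, 'e) pre_digraph \<Rightarrow> ('v, 'e) qpath \<times> ('v, 'e) qpath
      \<Rightarrow> ('v, 'e) qpath \<times> ('v, 'e) qpath" where
  "tau Q w = (let p = snd (fst w); x = tail Q (last p)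
              in ((x, last p # butlast p), (x, [])))"

text \<open>\<open>tau Q\<close> permutes \<open>cycle_pairs Q I n\<close>; negative powers use the inverse permutation.\<close>

definition tau_pow ::
    "('v, 'e) pre_digraph \<Rightarrow> (('v, 'e) qpath \<Rightarrow> 'k :: field) set \<Rightarrow> nat \<Rightarrow> int
      \<Rightarrow> ('v, 'e) qpath \<times> ('v, 'e) qpath \<Rightarrow> ('v, 'e) qpath \<times> ('v, 'e) qpath" where
  "tau_pow Q I n m =
    (if m \<ge> 0 then tau Q ^^ nat m
     else inv_into (cycle_pairs Q I n) (tau Q) ^^ nat (- m))"

definition cycle_pairs0 ::
    "('v, 'e) pre_digraph \<Rightarrow> (('v, 'e) qpath \<Rightarrow> 'k :: field) set \<Rightarrow> nat
      \<Rightarrow> (('v, 'e) qpath \<times> ('v, 'e) qpath) set" where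
  "cycle_pairs0 Q I n =
    {w \<in> cycle_pairs Q I n. let p = snd (fst w) in
        \<not> (\<exists>c. c \<noteq> last p \<and> arrows_in Q I c (hd p)) \<and>
        \<not> (\<exists>b. b \<noteq> hd p \<and> arrows_in Q I (last p) b)}"

definition gentle_pairs ::
    "('v, 'e) pre_digraph \<Rightarrow> (('v, 'e) qpath \<Rightarrow> 'k :: field) set \<Rightarrow> nat
      \<Rightarrow> (('v, 'e) qpath \<times> ('v, 'e) qpath) set" where
  "gentle_pairs Q I n =
    {w \<in> cycle_pairs Q I n. \<forall>m::int. tau_pow Q I n m w \<in> cycle_pairs0 Q I n}"


section \<open>Hochschild cohomology relative to a subring\<close>

text \<open>
  For a ring \<open>A\<close> with subring \<open>E\<close>, an element of \<open>Hom\<^bsub>E-E\<^esub>(A \<otimes>\<^sub>E \<dots> \<otimes>\<^sub>E A, A)\<close> (\<open>n\<close> factors)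
  is given, through the universal property of the tensor product, by its values on pure
  tensors: a map on \<open>n\<close>-tuples that is additive in each entry, balanced over \<open>E\<close>, and
  \<open>E\<close>-linear on the left and on the right. For \<open>A = kQ/I\<close> and \<open>E = kQ\<^sub>0\<close> no separate
  \<open>k\<close>-linearity is needed, since the scalars lie in \<open>E\<close> and are central in \<open>A\<close>.
  For \<open>n = 0\<close> the tensor power is \<open>E\<close> itself, and an \<open>E\<close>-bimodule map \<open>E \<rightarrow> A\<close> is given by
  its value at \<open>1\<close>, an element of \<open>A\<close> commuting with \<open>E\<close>; it is stored as the value at the
  empty tuple.
\<close>

definition tuples :: "('a, 'b) ring_scheme \<Rightarrow> nat \<Rightarrow> 'a list set" where
  "tuples A n = {vs. set vs \<subseteq> carrier A \<and> length vs = n}"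

definition is_bimod_hom :: "'a ring \<Rightarrow> 'a set \<Rightarrow> nat \<Rightarrow> ('a list \<Rightarrow> 'a) \<Rightarrow> bool" where
  "is_bimod_hom A E n f \<longleftrightarrow>
     f \<in> (\<Pi>\<^sub>E vs \<in> tuples A n. carrier A) \<and>
     (\<forall>us a b vs. us @ [a] @ vs \<in> tuples A n \<and> b \<in> carrier A \<longrightarrow>
        f (us @ [a \<oplus>\<^bsub>A\<^esub> b] @ vs) = f (us @ [a] @ vs) \<oplus>\<^bsub>A\<^esub> f (us @ [b] @ vs)) \<and>
     (\<forall>us a e b vs. us @ [a, b] @ vs \<in> tuples A n \<and> e \<in> E \<longrightarrow>
        f (us @ [a \<otimes>\<^bsub>A\<^esub> e, b] @ vs) = f (us @ [a, e \<otimes>\<^bsub>A\<^esub> b] @ vs)) \<and>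
     (\<forall>e a vs. a # vs \<in> tuples A n \<and> e \<in> E \<longrightarrow>
        f ((e \<otimes>\<^bsub>A\<^esub> a) # vs) = e \<otimes>\<^bsub>A\<^esub> f (a # vs)) \<and>
     (\<forall>e a vs. vs @ [a] \<in> tuples A n \<and> e \<in> E \<longrightarrow>
        f (vs @ [a \<otimes>\<^bsub>A\<^esub> e]) = f (vs @ [a]) \<otimes>\<^bsub>A\<^esub> e) \<and>
     (n = 0 \<longrightarrow> (\<forall>e\<in>E. e \<otimes>\<^bsub>A\<^esub> f [] = f [] \<otimes>\<^bsub>A\<^esub> e))"

definition cochains :: "'a ring \<Rightarrow> 'a set \<Rightarrow> nat \<Rightarrow> ('a list \<Rightarrow> 'a) monoid" where
  "cochains A E n =
    \<lparr> carrier = {f. is_bimod_hom A E n f},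
      mult = (\<lambda>f g. \<lambda>vs\<in>tuples A n. f vs \<oplus>\<^bsub>A\<^esub> g vs),
      one = (\<lambda>vs\<in>tuples A n. \<zero>\<^bsub>A\<^esub>) \<rparr>"

definition sgnd :: "('a, 'b) ring_scheme \<Rightarrow> nat \<Rightarrow> 'a \<Rightarrow> 'a" where
  "sgnd A i a = (if even i then a else \<ominus>\<^bsub>A\<^esub> a)"

text \<open>
  \<open>(\<delta>f)(v\<^sub>1,\<dots>,v\<^bsub>n+1\<^esub>) = v\<^sub>1 f(v\<^sub>2,\<dots>) + \<Sum> (-1)\<^sup>i f(\<dots>,v\<^sub>i v\<^bsub>i+1\<^esub>,\<dots>) + (-1)\<^bsup>n+1\<^esup> f(v\<^sub>1,\<dots>,v\<^sub>n) v\<^bsub>n+1\<^esub>\<close>;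
  list positions count from 0.
\<close>

definition cobd :: "'a ring \<Rightarrow> nat \<Rightarrow> ('a list \<Rightarrow> 'a) \<Rightarrow> 'a list \<Rightarrow> 'a" where
  "cobd A n f = (\<lambda>vs\<in>tuples A (Suc n).
     (hd vs \<otimes>\<^bsub>A\<^esub> f (tl vs))
     \<oplus>\<^bsub>A\<^esub> (\<Oplus>\<^bsub>A\<^esub>i\<in>{1..n}. sgnd A i
            (f (take (i - 1) vs @ [vs ! (i - 1) \<otimes>\<^bsub>A\<^esub> vs ! i] @ drop (i + 1) vs)))
     \<oplus>\<^bsub>A\<^esub> sgnd A (Suc n) (f (butlast vs) \<otimes>\<^bsub>A\<^esub> last vs))"

definition cocycles :: "'a ring \<Rightarrow> 'a set \<Rightarrow> nat \<Rightarrow> ('a list \<Rightarrow> 'a) set" where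
  "cocycles A E n = kernel (cochains A E n) (cochains A E (Suc n)) (cobd A n)"

definition coboundaries :: "'a ring \<Rightarrow> 'a set \<Rightarrow> nat \<Rightarrow> ('a list \<Rightarrow> 'a) set" where
  "coboundaries A E n =
    (case n of 0 \<Rightarrow> {\<one>\<^bsub>cochains A E 0\<^esub>} | Suc m \<Rightarrow> cobd A m ` carrier (cochains A E m))"

text \<open>Cochain groups, and hence \<open>HH\<close>, are written multiplicatively as monoid records: the
  group operation is addition of cochains, and the unit of \<open>HH A E n\<close> is the zero class.\<close>

definition HH :: "'a ring \<Rightarrow> 'a set \<Rightarrow> nat \<Rightarrow> ('a list \<Rightarrow> 'a) set monoid" where
  "HH A E n = (cochains A E n)\<lparr>carrier := cocycles A E n\<rparr> Mod coboundaries A E n"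

definition cup_cochain ::
    "'a ring \<Rightarrow> nat \<Rightarrow> nat \<Rightarrow> ('a list \<Rightarrow> 'a) \<Rightarrow> ('a list \<Rightarrow> 'a) \<Rightarrow> 'a list \<Rightarrow> 'a" where
  "cup_cochain A n m f g = (\<lambda>vs\<in>tuples A (n + m). f (take n vs) \<otimes>\<^bsub>A\<^esub> g (drop n vs))"

text \<open>As for products in quotient rings (\<^const>\<open>rcoset_mult\<close>), the product of two classes is the
  union of the classes of the products of all representatives.\<close>

definition cup ::
    "'a ring \<Rightarrow> 'a set \<Rightarrow> nat \<Rightarrow> nat \<Rightarrow> ('a list \<Rightarrow> 'a) set \<Rightarrow> ('a list \<Rightarrow> 'a) set
      \<Rightarrow> ('a list \<Rightarrow> 'a) set" where
  "cup A E n m u v =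
    (\<Union>f\<in>u. \<Union>g\<in>v. coboundaries A E (n + m) #>\<^bsub>cochains A E (n + m)\<^esub> cup_cochain A n m f g)"

definition cup_nonzero :: "'a ring \<Rightarrow> 'a set \<Rightarrow> nat \<Rightarrow> nat \<Rightarrow> bool" where
  "cup_nonzero A E a b \<longleftrightarrow>
    (\<exists>u\<in>carrier (HH A E a). \<exists>v\<in>carrier (HH A E b). cup A E a b u v \<noteq> \<one>\<^bsub>HH A E (a + b)\<^esub>)"

end

theory Submission
  imports Defs "HOL-Library.Function_Algebras"
begin

text \<open>
  Why the theorem holds. In a gentle pair \<open>(\<alpha>\<^sub>1 \<dots> \<alpha>\<^sub>n, e)\<close> every arrow of the cycle has
  exactly one continuation by a relation, forwards and backwards, and it is its neighbour on the
  cycle. Write \<open>\<sigma>\<close> for the successor of an arrow on the cycle. For \<open>N\<close> a multiple of \<open>n\<close>, the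
  \<open>N\<close>-tuples \<open>(a, \<sigma> a, \<dots>)\<close> of arrows of the cycle are the associated paths of the quadratic
  monomial algebra that stay on the cycle, and sending each of them to the vertex where it starts,
  and all other associated paths to zero, is a cocycle on the minimal (Koszul) resolution as soon
  as \<open>(-1)\<^sup>N = 1\<close> in the field: the only two terms of the differential that survive are
  \<open>a\<close> and \<open>(-1)\<^sup>N\<^sup>+\<^sup>1 a\<close>.

  Through the comparison map with the bar resolution this becomes an explicit bar cocycle. For
  \<open>N \<ge> 2\<close> it sends \<open>(v\<^sub>1, \<dots>, v\<^sub>N)\<close> to the sum over the arrows \<open>a\<close> of the cycle of
  \<open>(v\<^sub>1 / a) c(v\<^sub>2) \<dots> c(v\<^bsub>N-1\<^esub>) (\<sigma>\<^bsup>N-1\<^esup> a \ v\<^sub>N)\<close>, where \<open>v / a\<close> deletes a final arrow \<open>a\<close>,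
  \<open>b \ v\<close> deletes an initial arrow \<open>b\<close>, and the inner factors are coefficients of
  the arrows \<open>\<sigma> a, \<sigma>\<^sup>2 a, \<dots>\<close> (\<open>cycle_cochain\<close>). For \<open>N = 1\<close>, which occurs for a loop in
  characteristic two, it is the derivation that deletes the loop (\<open>loop_cochain\<close>). In
  both cases the cocycle identity is a computation with the twisted Leibniz rules \<open>ldiv_mul\<close> and
  \<open>rdiv_mul\<close> of the two deletion operators; their error terms, caused by products that fall into
  the ideal, come in pairs that are shifted against each other along the cycle, and add up to
  \<open>1 - (-1)\<^sup>N = 0\<close> times a common sum.

  That the product of two such classes does not vanish needs no knowledge of the cohomology. On the
  tuple \<open>(a, \<sigma> a, \<sigma>\<^sup>2 a, \<dots>)\<close> all inner terms of a coboundary contain a product of two consecutive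
  arrows, which is zero, and its two outer terms are multiples of an arrow. So the value of a
  coboundary has no vertex component, whereas the cup product takes the value
  \<open>e e = e\<close> up to terms without vertex component (\<open>cup_nonzeroI\<close>).

  All computations take place in normal forms: an element of \<open>A = kQ/I\<close> is identified with its
  representative supported on the paths without a subpath in \<open>I\<close>.
\<close>

section \<open>A monomial ideal and the paths that avoid it\<close>

locale monomial_quotient = fin_digraph Q
  for Q :: "('v, 'e) pre_digraph" +
  fixes I :: "(('v, 'e) qpath \<Rightarrow> 'k :: field) set"
    and P :: "('v, 'e) qpath set"
  assumes I_ideal: "ideal I (path_algebra Q)"
    and P_quadratic: "P \<subseteq> {x \<in> qpaths Q. length (snd x) = 2}"
    and I_gen: "I = Idl\<^bsub>path_algebra Q\<^esub> (path_elem ` P)"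
    and I_admissible: "\<exists>m. arrow_ideal_pow Q m \<subseteq> I"
begin

abbreviation R :: "(('v, 'e) qpath \<Rightarrow> 'k) ring" where "R \<equiv> path_algebra Q"
abbreviation A :: "(('v, 'e) qpath \<Rightarrow> 'k) set ring" where "A \<equiv> qalgebra Q I"

lemma ring_R: "ring R"
  by (rule path_algebra_ring) unfold_locales

sublocale I: ideal I R
  by (rule I_ideal)

lemma ring_A: "ring A"
  unfolding qalgebra_def by (rule I.quotient_is_ring)

sublocale A: ring A
  by (rule ring_A)

text \<open>The paths that are nonzero in the quotient; being quadratic, the relations need only be
  tested on consecutive arrows.\<close>
definition good :: "('v, 'e) qpath \<Rightarrow> bool" where
  "good x \<longleftrightarrow> x \<in> qpaths Q \<and> successively (\<lambda>a b. \<not> arrows_in Q I a b) (snd x)"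

lemma good_append:
  "good (u, p @ q) \<longleftrightarrow> good (u, p) \<and> good (awlast u p, q) \<and>
     (p = [] \<or> q = [] \<or> \<not> arrows_in Q I (last p) (hd q))"
  using qpaths_split[OF wf_digraph_axioms, of u "p @ q" "length p"]
  by (auto simp: good_def successively_append_iff)

lemma good_Nil [simp]: "good (u, []) \<longleftrightarrow> u \<in> verts Q"
  by (auto simp: good_def qpaths_def awalk_Nil_iff)

lemma good_Cons:
  "good (u, a # q) \<longleftrightarrow> a \<in> arcs Q \<and> tail Q a = u \<and> good (head Q a, q) \<and>
     (q = [] \<or> \<not> arrows_in Q I a (hd q))"
  by (auto simp: good_def qpaths_def awalk_Cons_iff successively_Cons)

lemma good_snoc:
  "good (u, p @ [a]) \<longleftrightarrow> good (u, p) \<and> a \<in> arcs Q \<and> tail Q a = awlast u p \<and>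
     (p = [] \<or> \<not> arrows_in Q I (last p) a)"
  by (auto simp: good_append good_Cons)

lemma good_take: "good (u, p) \<Longrightarrow> good (u, take i p)"
  and good_drop: "good (u, p) \<Longrightarrow> good (awlast u (take i p), drop i p)"
  using good_append[of u "take i p" "drop i p"] by auto

lemma awlast_single [simp]: "awlast u [a] = head Q a"
  by (simp add: pre_digraph.awalk_verts_conv)

lemma awlast_Cons: "awlast u (a # p) = awlast (head Q a) p"
  using ptarget_append[of Q u "[a]" p] by simp

lemma awlast_snoc [simp]: "awlast u (p @ [a]) = head Q a"
  using ptarget_append[of Q u p "[a]"] by simp

lemma awlast_Nil [simp]: "awlast u [] = u"
  by (simp add: pre_digraph.awalk_verts_conv)

lemma R_mult_split:
  assumes "(f \<otimes>\<^bsub>R\<^esub> g) (u, p) \<noteq> 0"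
  obtains i where "f (u, take i p) \<noteq> 0" "g (awlast u (take i p), drop i p) \<noteq> 0"
proof -
  from assms obtain i where "f (u, take i p) * g (awlast u (take i p), drop i p) \<noteq> 0"
    unfolding path_algebra_mult by (metis (mono_tags, lifting) sum.neutral)
  with that show thesis by auto
qed

lemma smult_path_elem_in_carrier:
  "x \<in> qpaths Q \<Longrightarrow> (\<lambda>y. c * path_elem x y) \<in> carrier R"
  by (auto simp: path_algebra_simps path_elem_def
      intro: finite_subset[of _ "{x}"] split: if_splits)

lemma path_elem_in_carrier [simp]: "x \<in> qpaths Q \<Longrightarrow> path_elem x \<in> carrier R"
  using smult_path_elem_in_carrier[of x 1] by simp

lemma arrow_in_qpaths [simp]: "a \<in> arcs Q \<Longrightarrow> (tail Q a, [a]) \<in> qpaths Q"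
  by (auto simp: qpaths_def awalk_Cons_iff awalk_Nil_iff)

text \<open>A subpath of a good path is good, so in a product that is nonzero at a good path both factors
  are nonzero at good paths. This is the upper bound for the relation ideal.\<close>
lemma vanish_on_good_ideal: "ideal {g \<in> carrier R. \<forall>x. good x \<longrightarrow> g x = 0} R" (is "ideal ?J R")
proof (rule idealI[OF ring_R])
  have neg: "\<ominus>\<^bsub>R\<^esub> g = (\<lambda>x. - g x)" if "g \<in> carrier R" for g
  proof -
    have "(\<lambda>x. - g x) \<in> carrier R" using that by (auto simp: path_algebra_simps)
    moreover have "(\<lambda>x. - g x) \<oplus>\<^bsub>R\<^esub> g = \<zero>\<^bsub>R\<^esub>" by (simp add: path_algebra_simps)
    ultimately show ?thesis using that by (simp add: I.minus_equality)
  qed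
  show "subgroup ?J (add_monoid R)"
  proof (rule group.subgroupI[OF I.add.is_group])
    have "\<zero>\<^bsub>R\<^esub> \<in> ?J" using I.zero_closed by (auto simp: path_algebra_simps(2) simp del: I.zero_closed)
    then show "?J \<noteq> {}" by blast
    fix g assume g: "g \<in> ?J"
    have "inv\<^bsub>add_monoid R\<^esub> g = \<ominus>\<^bsub>R\<^esub> g" by (simp add: a_inv_def)
    then show "inv\<^bsub>add_monoid R\<^esub> g \<in> ?J"
      using g neg[of g] I.a_inv_closed[of g] by auto
    fix h assume "h \<in> ?J"
    with g show "g \<otimes>\<^bsub>add_monoid R\<^esub> h \<in> ?J"
      using I.a_closed[of g h] by (auto simp: path_algebra_simps(3) simp del: I.a_closed)
  qed auto
next
  fix g h assume g: "g \<in> ?J" and h: "h \<in> carrier R"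
  have "(h \<otimes>\<^bsub>R\<^esub> g) x = 0" if x: "good x" for x
  proof (rule ccontr)
    obtain u p where [simp]: "x = (u, p)" by force
    assume "(h \<otimes>\<^bsub>R\<^esub> g) x \<noteq> 0"
    then obtain i where "g (awlast u (take i p), drop i p) \<noteq> 0" using R_mult_split by (metis \<open>x = (u, p)\<close>)
    then show False using g good_drop[of u p i] x by auto
  qed
  with g h show "h \<otimes>\<^bsub>R\<^esub> g \<in> ?J" by auto
  have "(g \<otimes>\<^bsub>R\<^esub> h) x = 0" if x: "good x" for x
  proof (rule ccontr)
    obtain u p where [simp]: "x = (u, p)" by force
    assume "(g \<otimes>\<^bsub>R\<^esub> h) x \<noteq> 0"
    then obtain i where "g (u, take i p) \<noteq> 0" using R_mult_split by (metis \<open>x = (u, p)\<close>)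
    then show False using g good_take[of u p i] x by auto
  qed
  with g h show "g \<otimes>\<^bsub>R\<^esub> h \<in> ?J" by auto
qed

lemma I_vanishes_on_good:
  assumes "g \<in> I" "good x"
  shows "g x = 0"
proof -
  let ?J = "{g \<in> carrier R. \<forall>x. good x \<longrightarrow> g x = 0}"
  have "path_elem ` P \<subseteq> ?J"
  proof clarsimp
    fix u p assume p: "(u, p) \<in> P"
    then obtain a b where [simp]: "p = [a, b]" and q: "(u, p) \<in> qpaths Q"
      using P_quadratic by (auto simp: length_Suc_conv numeral_2_eq_2)
    have "path_elem (u, p) \<in> Idl\<^bsub>R\<^esub> (path_elem ` P)"
      using P_quadratic p by (intro subsetD[OF I.genideal_self]) auto
    with q have "arrows_in Q I a b"
      unfolding arrows_in_def I_gen by (auto simp: qpaths_def awalk_Cons_iff)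
    then have "\<not> good (u, p)" by (simp add: good_Cons)
    with q show "path_elem (u, p) \<in> carrier R \<and> (\<forall>v q. good (v, q) \<longrightarrow> path_elem (u, p) (v, q) = (0 :: 'k))"
      using path_elem_in_carrier[OF q] by (intro conjI) (assumption, auto simp: path_elem_def)
  qed
  then have "Idl\<^bsub>R\<^esub> (path_elem ` P) \<subseteq> ?J"
    by (intro I.genideal_minimal vanish_on_good_ideal)
  then have "I \<subseteq> ?J" by (rule subset_trans[OF eq_refl[OF I_gen]])
  with assms show ?thesis by blast
qed

lemma bad_path_in_I:
  assumes "(u, p) \<in> qpaths Q" "\<not> good (u, p)"
  shows "path_elem (u, p) \<in> I"
proof -
  note fin = fin_digraph_axioms
  from assms obtain i where i: "Suc i < length p" "arrows_in Q I (p ! i) (p ! Suc i)"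
    by (auto simp: good_def successively_conv_nth)
  let ?a = "p ! i" and ?b = "p ! Suc i"
  define v where "v = awlast u (take i p)"
  have p: "p = take i p @ [?a, ?b] @ drop (Suc (Suc i)) p"
    using i by (simp add: Cons_nth_drop_Suc)
  note split = qpaths_split[OF wf_digraph_axioms]
  have q1: "(u, take i p) \<in> qpaths Q" and q2: "(v, [?a, ?b] @ drop (Suc (Suc i)) p) \<in> qpaths Q"
    using split[of u p i] assms(1) i by (auto simp: v_def Cons_nth_drop_Suc)
  let ?w = "head Q ?b"
  have q3: "(v, [?a, ?b]) \<in> qpaths Q" and q4: "(?w, drop (Suc (Suc i)) p) \<in> qpaths Q"
    using split[of v "[?a, ?b] @ drop (Suc (Suc i)) p" 2] q2 by (auto simp: awlast_Cons)
  have "tail Q ?a = v" using q3 by (auto simp: qpaths_def awalk_Cons_iff)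
  with i have "path_elem (v, [?a, ?b]) \<in> I" by (simp add: arrows_in_def)
  then have "path_elem (u, take i p) \<otimes>\<^bsub>R\<^esub> path_elem (v, [?a, ?b]) \<otimes>\<^bsub>R\<^esub> path_elem (?w, drop (Suc (Suc i)) p) \<in> I"
    using q1 q3 q4 by (intro I.I_r_closed I.I_l_closed) auto
  moreover have q5: "(u, take i p @ [?a, ?b]) \<in> qpaths Q"
    using split[of u "take i p @ [?a, ?b]" i] q1 q3 i by (simp add: v_def)
  ultimately show ?thesis
    using path_elem_mult[OF fin q1 q3, where ?'k = 'k] path_elem_mult[OF fin q5 q4, where ?'k = 'k] p
    by (simp add: v_def ptarget_append awlast_Cons)
qed

lemma smult_in_I:
  assumes "g \<in> I"
  shows "(\<lambda>x. c * g x) \<in> I"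
proof -
  let ?e = "(\<lambda>x. c * \<one>\<^bsub>R\<^esub> x)"
  have g: "g \<in> carrier R" using assms by (rule I.Icarr)
  have "\<one>\<^bsub>R\<^esub> \<in> carrier R" by simp
  then have "?e \<in> carrier R"
    unfolding path_algebra_simps(1) by (auto intro: rev_finite_subset)
  then have "?e \<otimes>\<^bsub>R\<^esub> g \<in> I" using assms by (rule I.I_l_closed[rotated])
  moreover have "(?e \<otimes>\<^bsub>R\<^esub> g) (u, p) = c * (\<one>\<^bsub>R\<^esub> \<otimes>\<^bsub>R\<^esub> g) (u, p)" for u p
    by (simp add: path_algebra_mult sum_distrib_left mult.assoc del: I.l_one)
  then have "?e \<otimes>\<^bsub>R\<^esub> g = (\<lambda>x. c * g x)" using g by (auto simp: fun_eq_iff)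
  ultimately show ?thesis by simp
qed

text \<open>A relation ideal generated by paths is spanned by the paths in it; this makes normal forms
  well defined.\<close>
lemma I_iff: "g \<in> I \<longleftrightarrow> g \<in> carrier R \<and> (\<forall>x. good x \<longrightarrow> g x = 0)"
proof (intro iffI conjI)
  assume g: "g \<in> carrier R \<and> (\<forall>x. good x \<longrightarrow> g x = 0)"
  have "(\<lambda>x. \<Sum>y\<in>S. g y * path_elem y x) \<in> I" if "finite S" "S \<subseteq> {x. g x \<noteq> 0}" for S
    using that
  proof (induction S)
    case empty
    then show ?case using additive_subgroup.zero_closed[OF I.is_additive_subgroup] by (simp add: path_algebra_simps(2))
  next
    case (insert y S)
    obtain u p where y: "y = (u, p)" by force
    have "(\<lambda>x. g y * path_elem y x) \<in> I"
      unfolding y using g insert.prems y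
      by (intro smult_in_I bad_path_in_I) (auto simp: path_algebra_simps(1))
    then have "(\<lambda>x. g y * path_elem y x) \<oplus>\<^bsub>R\<^esub> (\<lambda>x. \<Sum>y\<in>S. g y * path_elem y x) \<in> I"
      using insert by (intro additive_subgroup.a_closed[OF I.is_additive_subgroup]) auto
    then show ?case using insert by (simp add: path_algebra_simps(3))
  qed
  then have "(\<lambda>x. \<Sum>y | g y \<noteq> 0. g y * path_elem y x) \<in> I"
    using g by (simp add: path_algebra_simps(1))
  moreover have "(\<Sum>y | g y \<noteq> 0. g y * path_elem y x) = g x" for x
  proof (cases "g x = 0")
    case False
    with g have "(\<Sum>y | g y \<noteq> 0. g y * path_elem y x) = (\<Sum>y\<in>{x}. g y * path_elem y x)"
      by (intro sum.mono_neutral_right) (auto simp: path_algebra_simps(1) path_elem_def)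
    then show ?thesis by (simp add: path_elem_def)
  qed (auto simp: path_elem_def intro: sum.neutral)
  ultimately show "g \<in> I" by simp
qed (auto intro: I_vanishes_on_good I.Icarr)

lemma path_elem_in_arrow_ideal_pow:
  "(u, p) \<in> qpaths Q \<Longrightarrow> path_elem (u, p) \<in> (arrow_ideal_pow Q (length p) :: (_ \<Rightarrow> 'k) set)"
proof (induction p arbitrary: u)
  case Nil
  then show ?case by (simp add: arrow_ideal_pow_def)
next
  case (Cons a p)
  from Cons.prems have a: "a \<in> arcs Q" "tail Q a = u" "(head Q a, p) \<in> qpaths Q" "(u, [a]) \<in> qpaths Q"
    by (auto simp: qpaths_def awalk_Cons_iff awalk_Nil_iff)
  have "path_elem (u, [a]) \<in> (arrow_ideal Q :: (_ \<Rightarrow> 'k) set)"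
    unfolding arrow_ideal_def
    by (rule subsetD[OF I.genideal_self]) (use a in auto)
  then have "path_elem (u, [a]) \<otimes>\<^bsub>R\<^esub> path_elem (head Q a, p) \<in> arrow_ideal_pow Q (length (a # p))"
    unfolding arrow_ideal_pow_def using Cons.IH[OF a(3)]
    by (auto simp: arrow_ideal_pow_def intro: ideal_prod.prod)
  then show ?case
    using path_elem_mult[OF fin_digraph_axioms a(4) a(3), where ?'k = 'k] by simp
qed

text \<open>Long paths lie in a power of the arrow ideal, hence in \<open>I\<close>. Thanks to this finiteness every
  function supported on good paths is an element of the path algebra, and no support condition
  has to be carried along below.\<close>
lemma finite_good: "finite {x. good x}"
proof -
  obtain m where m: "arrow_ideal_pow Q m \<subseteq> I" using I_admissible by blast
  have "length p < m" if "good (u, p)" for u p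
  proof (rule ccontr)
    assume "\<not> length p < m"
    then have len: "length (take m p) = m" by simp
    have g: "good (u, take m p)" using that by (rule good_take)
    then have "path_elem (u, take m p) \<in> I"
      using m path_elem_in_arrow_ideal_pow[of u "take m p"] len by (auto simp: good_def)
    from I_vanishes_on_good[OF this g] show False by (simp add: path_elem_def)
  qed
  moreover have "set p \<subseteq> arcs Q" "u \<in> verts Q" if "good (u, p)" for u p
    using that by (auto simp: good_def qpaths_def)
  ultimately have "{x. good x} \<subseteq> verts Q \<times> {p. set p \<subseteq> arcs Q \<and> length p \<le> m}"
    by force
  then show ?thesis by (rule finite_subset) (intro finite_cartesian_product finite_lists_length_le finite_verts finite_arcs)
qed

section \<open>Normal forms in the quotient algebra\<close>

definition normal :: "(('v, 'e) qpath \<Rightarrow> 'k) \<Rightarrow> bool" where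
  "normal g \<longleftrightarrow> (\<forall>x. \<not> good x \<longrightarrow> g x = 0)"

definition normalize :: "(('v, 'e) qpath \<Rightarrow> 'k) \<Rightarrow> ('v, 'e) qpath \<Rightarrow> 'k" where
  "normalize g = (\<lambda>x. if good x then g x else 0)"

text \<open>The multiplication of \<open>A\<close> in normal forms.\<close>
definition mul :: "(('v, 'e) qpath \<Rightarrow> 'k) \<Rightarrow> (('v, 'e) qpath \<Rightarrow> 'k) \<Rightarrow> ('v, 'e) qpath \<Rightarrow> 'k" where
  "mul g h = normalize (g \<otimes>\<^bsub>R\<^esub> h)"

definition smul :: "'k \<Rightarrow> (('v, 'e) qpath \<Rightarrow> 'k) \<Rightarrow> ('v, 'e) qpath \<Rightarrow> 'k" where
  "smul c g = (\<lambda>x. c * g x)"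

definition cl :: "(('v, 'e) qpath \<Rightarrow> 'k) \<Rightarrow> (('v, 'e) qpath \<Rightarrow> 'k) set" where
  "cl g = I +>\<^bsub>R\<^esub> g"

text \<open>The maps \<open>cl\<close> and \<open>nf\<close> are mutually inverse between normal functions and \<open>A\<close>.\<close>
definition nf :: "(('v, 'e) qpath \<Rightarrow> 'k) set \<Rightarrow> ('v, 'e) qpath \<Rightarrow> 'k" where
  "nf v = normalize (SOME g. g \<in> carrier R \<and> v = cl g)"

lemma smul_apply [simp]: "smul c g x = c * g x"
  by (simp add: smul_def)

lemma mul_apply:
  "mul g h (u, p) = (if good (u, p)
     then \<Sum>i\<le>length p. g (u, take i p) * h (awlast u (take i p), drop i p) else 0)"
  by (auto simp: mul_def normalize_def path_algebra_mult good_def)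

lemma normal_mul [simp]: "normal (mul g h)"
  and normal_normalize [simp]: "normal (normalize g)"
  by (auto simp: normal_def mul_def normalize_def)

lemma normal_add [simp]: "normal g \<Longrightarrow> normal h \<Longrightarrow> normal (g + h)"
  and normal_diff [simp]: "normal g \<Longrightarrow> normal h \<Longrightarrow> normal (g - h)"
  and normal_uminus [simp]: "normal g \<Longrightarrow> normal (- g)"
  and normal_zero [simp]: "normal 0"
  and normal_smul [simp]: "normal g \<Longrightarrow> normal (smul c g)"
  by (auto simp: normal_def)

lemma normal_sum [simp]: "(\<And>a. a \<in> S \<Longrightarrow> normal (f a)) \<Longrightarrow> normal (\<Sum>a\<in>S. f a)"
  by (induction S rule: infinite_finite_induct) auto

lemma normalize_normal [simp]: "normal g \<Longrightarrow> normalize g = g"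
  by (auto simp: normal_def normalize_def)

lemma normal_path_elem [simp]: "good x \<Longrightarrow> normal (path_elem x)"
  by (auto simp: normal_def path_elem_def)

lemma normal_in_carrier: "normal g \<Longrightarrow> g \<in> carrier R"
proof -
  assume "normal g"
  then have "{x. g x \<noteq> 0} \<subseteq> {x. good x}" by (auto simp: normal_def)
  moreover have "{x. good x} \<subseteq> qpaths Q" by (auto simp: good_def)
  ultimately show ?thesis
    unfolding path_algebra_simps(1) using finite_subset[OF _ finite_good] by blast
qed

lemma mul_add_left: "mul (g + g') h = mul g h + mul g' h"
  and mul_add_right: "mul g (h + h') = mul g h + mul g h'"
  and mul_diff_left: "mul (g - g') h = mul g h - mul g' h"
  and mul_diff_right: "mul g (h - h') = mul g h - mul g h'"
  and mul_minus_left: "mul (- g) h = - mul g h"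
  and mul_minus_right: "mul g (- h) = - mul g h"
  and mul_zero_left [simp]: "mul 0 h = 0"
  and mul_zero_right [simp]: "mul g 0 = 0"
  and mul_smul_left: "mul (smul c g) h = smul c (mul g h)"
  and mul_smul_right: "mul g (smul c h) = smul c (mul g h)"
  by (auto simp: fun_eq_iff mul_apply algebra_simps sum.distrib sum_subtractf sum_negf sum_distrib_left)

lemma mul_sum_left: "mul (\<Sum>a\<in>S. f a) h = (\<Sum>a\<in>S. mul (f a) h)"
  using sum_comp_morphism[of "\<lambda>g. mul g h" f S] by (simp add: mul_add_left o_def)

lemma mul_sum_right: "mul h (\<Sum>a\<in>S. f a) = (\<Sum>a\<in>S. mul h (f a))"
  using sum_comp_morphism[of "mul h" f S] by (simp add: mul_add_right o_def)

lemma smul_add: "smul c (g + h) = smul c g + smul c h"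
  and smul_diff: "smul c (g - h) = smul c g - smul c h"
  and smul_add_scalar: "smul (c + d) g = smul c g + smul d g"
  and smul_smul [simp]: "smul c (smul d g) = smul (c * d) g"
  and smul_zero [simp]: "smul c 0 = 0"
  and smul_one [simp]: "smul 1 g = g"
  and smul_zero_scalar [simp]: "smul 0 g = 0"
  and smul_minus_scalar: "smul (- c) g = - smul c g"
  by (auto simp: fun_eq_iff algebra_simps)

lemma smul_sum: "smul c (\<Sum>a\<in>S. f a) = (\<Sum>a\<in>S. smul c (f a))"
  using sum_comp_morphism[of "smul c" f S] by (simp add: smul_add o_def)

text \<open>Both sides sum over the ways to cut a path in three; pieces of good paths are good, so the
  truncation to good paths does not interfere.\<close>
lemma mul_assoc: "mul (mul f g) h = mul f (mul g h)"
proof (rule ext, clarify)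
  fix u p
  show "mul (mul f g) h (u, p) = mul f (mul g h) (u, p)"
  proof (cases "good (u, p)")
    case True
    note s = good_take[OF True] good_drop[OF True]
    have "mul (mul f g) h (u, p) = (\<Sum>i\<le>length p. \<Sum>j\<le>i. f (u, take j p) *
       g (awlast u (take j p), drop j (take i p)) * h (awlast u (take i p), drop i p))"
      using True s by (auto simp: mul_apply sum_distrib_right min_def intro!: sum.cong)
    also have "\<dots> = (\<Sum>j\<le>length p. \<Sum>i\<le>length p - j. f (u, take j p) *
       g (awlast u (take j p), drop j (take (j+i) p)) * h (awlast u (take (j+i) p), drop (j+i) p))"
      by (rule sum_triangle_swap)
    also have "\<dots> = mul f (mul g h) (u, p)"
      using True s
      by (auto simp: mul_apply sum_distrib_left take_add drop_drop add.commute mult.assoc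
          ptarget_append[symmetric] simp flip: take_drop intro!: sum.cong)
    finally show ?thesis .
  qed (simp add: mul_apply)
qed

lemma cl_hom: "ring_hom_ring R A cl"
proof -
  have "cl = (+>\<^bsub>R\<^esub>) I" by (rule ext) (simp add: cl_def)
  then show ?thesis unfolding qalgebra_def using I.rcos_ring_hom_ring by metis
qed

sublocale cl: ring_hom_ring R A cl
  by (rule cl_hom)

lemma cl_eq_iff:
  assumes "g \<in> carrier R" "h \<in> carrier R"
  shows "cl g = cl h \<longleftrightarrow> normalize g = normalize h"
proof -
  have sub: "g \<ominus>\<^bsub>R\<^esub> h = g - h"
  proof -
    have "{x. (g - h) x \<noteq> 0} \<subseteq> {x. g x \<noteq> 0} \<union> {x. h x \<noteq> 0}" by auto
    then have 1: "g - h \<in> carrier R" using assms unfolding path_algebra_simps(1)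
      by (blast intro: finite_subset)
    have "(g - h) \<oplus>\<^bsub>R\<^esub> h = g" by (simp add: path_algebra_simps(3))
    with 1 assms show ?thesis
      using I.add.inv_solve_right[of "g - h" g h] by (simp add: I.minus_eq)
  qed
  have "cl g = cl h \<longleftrightarrow> g \<ominus>\<^bsub>R\<^esub> h \<in> I"
    unfolding cl_def using I.quotient_eq_iff_same_a_r_cos[OF I_ideal assms] by simp
  also have "\<dots> \<longleftrightarrow> normalize g = normalize h"
    using I.minus_closed[OF assms] by (auto simp: sub I_iff normalize_def fun_eq_iff)
  finally show ?thesis .
qed

lemma A_carrier_cases:
  assumes "v \<in> carrier A"
  obtains g where "g \<in> carrier R" "v = cl g"
  using assms unfolding qalgebra_def cl_def by (auto simp: FactRing_simps a_r_coset_def)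

lemma nf_cl: "g \<in> carrier R \<Longrightarrow> nf (cl g) = normalize g"
  unfolding nf_def
  by (rule someI2[where a = g and P = "\<lambda>h. h \<in> carrier R \<and> cl g = cl h"]) (auto simp: cl_eq_iff)

lemma nf_cl_normal [simp]: "normal g \<Longrightarrow> nf (cl g) = g"
  by (simp add: nf_cl normal_in_carrier)

lemma normal_nf [simp]: "normal (nf v)"
  by (simp add: nf_def)

lemma cl_in_A [simp]: "normal g \<Longrightarrow> cl g \<in> carrier A"
  by (simp add: normal_in_carrier)

lemma cl_nf [simp]: "v \<in> carrier A \<Longrightarrow> cl (nf v) = v"
  by (elim A_carrier_cases) (simp add: nf_cl cl_eq_iff normal_in_carrier)

lemma nf_inj: "v \<in> carrier A \<Longrightarrow> w \<in> carrier A \<Longrightarrow> nf v = nf w \<longleftrightarrow> v = w"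
  by (metis cl_nf)

lemma nf_add [simp]: "v \<in> carrier A \<Longrightarrow> w \<in> carrier A \<Longrightarrow> nf (v \<oplus>\<^bsub>A\<^esub> w) = nf v + nf w"
proof (elim A_carrier_cases)
  fix g h assume "g \<in> carrier R" "v = cl g" "h \<in> carrier R" "w = cl h"
  then have "nf (v \<oplus>\<^bsub>A\<^esub> w) = normalize (g \<oplus>\<^bsub>R\<^esub> h)"
    by (simp add: nf_cl flip: cl.hom_add)
  with \<open>v = cl g\<close> \<open>w = cl h\<close> \<open>g \<in> carrier R\<close> \<open>h \<in> carrier R\<close> show ?thesis
    by (auto simp: nf_cl path_algebra_simps(3) normalize_def fun_eq_iff)
qed

lemma nf_mult [simp]:
  assumes "v \<in> carrier A" "w \<in> carrier A"
  shows "nf (v \<otimes>\<^bsub>A\<^esub> w) = mul (nf v) (nf w)"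
proof -
  have "nf (v \<otimes>\<^bsub>A\<^esub> w) = nf (cl (nf v) \<otimes>\<^bsub>A\<^esub> cl (nf w))" using assms by simp
  also have "\<dots> = mul (nf v) (nf w)"
    using cl.hom_mult[of "nf v" "nf w"] nf_cl[of "nf v \<otimes>\<^bsub>R\<^esub> nf w"]
    by (simp add: normal_in_carrier mul_def)
  finally show ?thesis .
qed

lemma nf_zero [simp]: "nf \<zero>\<^bsub>A\<^esub> = 0"
proof -
  have "nf \<zero>\<^bsub>A\<^esub> + nf \<zero>\<^bsub>A\<^esub> = nf \<zero>\<^bsub>A\<^esub> + 0" by (subst nf_add[symmetric]) auto
  then show ?thesis by (simp only: add_left_cancel)
qed

lemma nf_uminus [simp]: "v \<in> carrier A \<Longrightarrow> nf (\<ominus>\<^bsub>A\<^esub> v) = - nf v"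
  by (metis A.a_inv_closed A.r_neg eq_neg_iff_add_eq_0 add.commute nf_add nf_zero)

lemma nf_sgnd [simp]: "v \<in> carrier A \<Longrightarrow> nf (sgnd A i v) = smul ((-1) ^ i) (nf v)"
  by (auto simp: sgnd_def smul_minus_scalar)

lemma nf_finsum:
  "finite S \<Longrightarrow> f \<in> S \<rightarrow> carrier A \<Longrightarrow> nf (\<Oplus>\<^bsub>A\<^esub>i\<in>S. f i) = (\<Sum>i\<in>S. nf (f i))"
proof (induction S rule: finite_induct)
  case (insert i S)
  then show ?case by (subst A.finsum_insert) (auto simp: Pi_iff)
qed simp

section \<open>Deleting an arrow at an end of a path\<close>

text \<open>On paths, \<open>ldiv a\<close> maps \<open>a p\<close> to \<open>p\<close> and \<open>rdiv a\<close> maps \<open>p a\<close> to \<open>p\<close>; all other paths go to zero. The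
  results are truncated in order to be normal for every argument.\<close>
definition ldiv :: "'e \<Rightarrow> (('v, 'e) qpath \<Rightarrow> 'k) \<Rightarrow> ('v, 'e) qpath \<Rightarrow> 'k" where
  "ldiv a g = normalize (\<lambda>(x, p). if x = head Q a then g (tail Q a, a # p) else 0)"

definition rdiv :: "'e \<Rightarrow> (('v, 'e) qpath \<Rightarrow> 'k) \<Rightarrow> ('v, 'e) qpath \<Rightarrow> 'k" where
  "rdiv a g = normalize (\<lambda>(x, p). g (x, p @ [a]))"

definition arr :: "'e \<Rightarrow> ('v, 'e) qpath \<Rightarrow> 'k" where
  "arr a = path_elem (tail Q a, [a])"

definition eps :: "'v \<Rightarrow> (('v, 'e) qpath \<Rightarrow> 'k) \<Rightarrow> 'k" where
  "eps x g = g (x, [])"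

definition acoeff :: "'e \<Rightarrow> (('v, 'e) qpath \<Rightarrow> 'k) \<Rightarrow> 'k" where
  "acoeff a g = g (tail Q a, [a])"

lemma normal_ldiv [simp]: "normal (ldiv a g)"
  and normal_rdiv [simp]: "normal (rdiv a g)"
  by (simp_all add: ldiv_def rdiv_def)

lemma ldiv_apply:
    "ldiv a g (x, p) = (if good (x, p) \<and> x = head Q a then g (tail Q a, a # p) else 0)"
  and rdiv_apply: "rdiv a g (x, p) = (if good (x, p) then g (x, p @ [a]) else 0)"
  by (auto simp: ldiv_def rdiv_def normalize_def)

lemma good_arrow [simp]: "good (tail Q a, [a]) \<longleftrightarrow> a \<in> arcs Q"
  by (auto simp: good_Cons)

lemma normal_arr [simp]: "a \<in> arcs Q \<Longrightarrow> normal (arr a)"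
  by (simp add: arr_def)

lemma ldiv_add: "ldiv a (g + h) = ldiv a g + ldiv a h"
  and rdiv_add: "rdiv a (g + h) = rdiv a g + rdiv a h"
  and acoeff_add: "acoeff a (g + h) = acoeff a g + acoeff a h"
  by (auto simp: ldiv_def rdiv_def acoeff_def normalize_def fun_eq_iff)

lemma eps_mul: "x \<in> verts Q \<Longrightarrow> eps x (mul g h) = eps x g * eps x h"
  by (simp add: eps_def mul_apply)

lemma acoeff_mul:
  "a \<in> arcs Q \<Longrightarrow> acoeff a (mul g h) = eps (tail Q a) g * acoeff a h + acoeff a g * eps (head Q a) h"
  by (simp add: acoeff_def eps_def mul_apply)

lemma mul_arr_left:
  assumes g: "good (u, p)"
  shows "mul (arr a) h (u, p) = (if p \<noteq> [] \<and> hd p = a then h (head Q a, tl p) else 0)"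
proof (cases p)
  case Nil
  then show ?thesis by (simp add: mul_apply arr_def path_elem_def)
next
  case (Cons b q)
  have 0: "arr a (u, take i p) = 0" if "i \<noteq> 1" "i \<le> length p" for i
  proof -
    have "length (take i p) \<noteq> length [a]" using that by simp
    then show ?thesis by (auto simp: arr_def path_elem_def simp del: length_take)
  qed
  have "mul (arr a) h (u, p) = (\<Sum>i\<le>length p. arr a (u, take i p) * h (awlast u (take i p), drop i p))"
    using g by (simp add: mul_apply)
  also have "\<dots> = (\<Sum>i\<in>{1}. arr a (u, take i p) * h (awlast u (take i p), drop i p))"
    by (rule sum.mono_neutral_right) (use 0 Cons in auto)
  finally show ?thesis using g Cons by (auto simp: arr_def path_elem_def good_Cons)
qed

lemma mul_arr_right:
  assumes g: "good (u, p)"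
  shows "mul h (arr a) (u, p) = (if p \<noteq> [] \<and> last p = a then h (u, butlast p) else 0)"
proof (cases p rule: rev_cases)
  case Nil
  then show ?thesis by (simp add: mul_apply arr_def path_elem_def)
next
  case (snoc q b)
  have 0: "arr a (v, drop i p) = 0" if "i \<noteq> length q" "i \<le> length p" for i v
  proof -
    have "length (drop i p) \<noteq> length [a]" using that snoc by simp
    then show ?thesis by (auto simp: arr_def path_elem_def simp del: length_drop)
  qed
  have "mul h (arr a) (u, p) = (\<Sum>i\<le>length p. h (u, take i p) * arr a (awlast u (take i p), drop i p))"
    using g by (simp add: mul_apply)
  also have "\<dots> = (\<Sum>i\<in>{length q}. h (u, take i p) * arr a (awlast u (take i p), drop i p))"
    by (rule sum.mono_neutral_right) (use 0 snoc in auto)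
  finally show ?thesis using g snoc by (auto simp: arr_def path_elem_def good_snoc)
qed

text \<open>The initial arrow of \<open>v w\<close> is that of \<open>v\<close>, unless \<open>v\<close> is a vertex: this gives the first two
  terms. The correction arises when \<open>v = a\<close> and \<open>w\<close> starts with the arrow \<open>b\<close> such that \<open>a b \<in> I\<close>:
  then \<open>v w\<close> is zero, but deleting \<open>a\<close> from the factor \<open>v\<close> leaves \<open>w\<close>.\<close>
lemma ldiv_mul:
  assumes ab: "\<And>c. arrows_in Q I a c \<longleftrightarrow> c = b"
    and g: "normal g" and h: "normal h"
  shows "ldiv a (mul g h) = mul (ldiv a g) h + smul (eps (tail Q a) g) (ldiv a h)
           - smul (acoeff a g) (mul (arr b) (ldiv b h))"
proof (rule ext, clarify)
  fix u p
  let ?r = "mul (ldiv a g) h + smul (eps (tail Q a) g) (ldiv a h)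
           - smul (acoeff a g) (mul (arr b) (ldiv b h))"
  have arcs: "a \<in> arcs Q" "b \<in> arcs Q" "head Q a = tail Q b" using ab[of b] by (auto simp: arrows_in_def)
  show "ldiv a (mul g h) (u, p) = ?r (u, p)"
  proof (cases "good (u, p)")
    case False
    then show ?thesis using normal_ldiv normal_mul by (simp add: normal_def)
  next
    case True
    have split: "(\<Sum>i\<le>length (a # p). g (tail Q a, take i (a # p)) * h (awlast (tail Q a) (take i (a # p)), drop i (a # p)))
      = eps (tail Q a) g * h (tail Q a, a # p) +
        (\<Sum>i\<le>length p. g (tail Q a, a # take i p) * h (awlast (head Q a) (take i p), drop i p))"
      by (simp add: sum.atMost_Suc_shift eps_def awlast_Cons del: sum.atMost_Suc)
    consider (other) "u \<noteq> head Q a" | (good) "u = head Q a" "good (tail Q a, a # p)" 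
      | (bad) "u = head Q a" "\<not> good (tail Q a, a # p)" by blast
    then show ?thesis
    proof cases
      case other
      have "mul (arr b) (ldiv b h) (u, p) = 0"
        using True other arcs by (cases p) (auto simp: mul_arr_left good_Cons)
      moreover have "mul (ldiv a g) h (u, p) = 0"
        using other by (simp add: mul_apply ldiv_apply)
      ultimately show ?thesis using other by (simp add: ldiv_apply)
    next
      case good
      have "mul (arr b) (ldiv b h) (u, p) = 0"
        using True good ab[of b] by (auto simp: mul_arr_left good_Cons)
      moreover have "mul (ldiv a g) h (u, p) = (\<Sum>i\<le>length p. g (tail Q a, a # take i p) * h (awlast (head Q a) (take i p), drop i p))"
        using True good_take[OF True] good by (auto simp: mul_apply ldiv_apply intro!: sum.cong)
      moreover have "ldiv a (mul g h) (u, p) = (\<Sum>i\<le>length (a # p). g (tail Q a, take i (a # p)) * h (awlast (tail Q a) (take i (a # p)), drop i (a # p)))"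
        using good True by (simp add: ldiv_apply mul_apply del: sum.atMost_Suc)
      ultimately show ?thesis unfolding split using good True by (simp add: ldiv_apply)
    next
      case bad
      then obtain q where p: "p = b # q" using True ab arcs
        by (cases p) (auto simp: good_Cons)
      have "g (tail Q a, a # take i p) = 0" if "i \<noteq> 0" for i
        using that g p ab[of b] by (cases i) (auto simp: normal_def good_Cons)
      then have "(\<Sum>i\<le>length p. g (tail Q a, a # take i p) * h (awlast (head Q a) (take i p), drop i p))
        = (\<Sum>i\<in>{0}. g (tail Q a, a # take i p) * h (awlast (head Q a) (take i p), drop i p))"
        by (intro sum.mono_neutral_right) auto
      then have "mul (ldiv a g) h (u, p) = acoeff a g * h (u, p)"
        using True good_take[OF True] bad by (auto simp: mul_apply ldiv_apply acoeff_def cong: sum.cong)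
      moreover have "mul (arr b) (ldiv b h) (u, p) = h (u, p)"
        using True p by (auto simp: mul_arr_left good_Cons ldiv_apply)
      moreover have "h (tail Q a, a # p) = 0" using h bad by (simp add: normal_def)
      moreover have "ldiv a (mul g h) (u, p) = 0" using bad by (simp add: ldiv_apply mul_apply)
      ultimately show ?thesis using bad True by (simp add: ldiv_apply)
    qed
  qed
qed

text \<open>The mirror image of the rule for \<open>ldiv\<close>.\<close>
lemma rdiv_mul:
  assumes ab: "\<And>c. arrows_in Q I c b \<longleftrightarrow> c = a"
    and g: "normal g" and h: "normal h"
  shows "rdiv b (mul g h) = mul g (rdiv b h) + smul (eps (head Q b) h) (rdiv b g)
           - smul (acoeff b h) (mul (rdiv a g) (arr a))"
proof (rule ext, clarify)
  fix u p
  let ?r = "mul g (rdiv b h) + smul (eps (head Q b) h) (rdiv b g)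
           - smul (acoeff b h) (mul (rdiv a g) (arr a))"
  have arcs: "a \<in> arcs Q" "b \<in> arcs Q" "head Q a = tail Q b" using ab[of a] by (auto simp: arrows_in_def)
  show "rdiv b (mul g h) (u, p) = ?r (u, p)"
  proof (cases "good (u, p)")
    case False
    then show ?thesis using normal_rdiv normal_mul by (simp add: normal_def)
  next
    case True
    have split: "(\<Sum>i\<le>length (p @ [b]). g (u, take i (p @ [b])) * h (awlast u (take i (p @ [b])), drop i (p @ [b])))
      = (\<Sum>i\<le>length p. g (u, take i p) * h (awlast u (take i p), drop i p @ [b])) + g (u, p @ [b]) * eps (head Q b) h"
      by (simp add: eps_def)
    consider (other) "awlast u p \<noteq> tail Q b" | (good) "awlast u p = tail Q b" "good (u, p @ [b])" 
      | (bad) "awlast u p = tail Q b" "\<not> good (u, p @ [b])" by blast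
    then show ?thesis
    proof cases
      case other
      have g0: "g (u, p @ [b]) = 0" using other g by (auto simp: normal_def good_snoc)
      have "h (awlast u (take i p), drop i p @ [b]) = 0" for i
      proof -
        have "awlast (awlast u (take i p)) (drop i p) = awlast u p"
          by (simp flip: ptarget_append)
        then show ?thesis using other h by (auto simp: normal_def good_snoc)
      qed
      then have "mul g (rdiv b h) (u, p) = 0"
        using other by (auto simp: mul_apply rdiv_apply intro!: sum.neutral)
      moreover have "mul (rdiv a g) (arr a) (u, p) = 0"
        using True other arcs by (cases p rule: rev_cases) (auto simp: mul_arr_right)
      moreover have "rdiv b (mul g h) (u, p) = 0"
        using other by (simp add: rdiv_apply mul_apply good_snoc)
      ultimately show ?thesis using g0 by (simp add: rdiv_apply)
    next
      case good
      have "mul (rdiv a g) (arr a) (u, p) = 0"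
        using True good ab[of a] by (auto simp: mul_arr_right good_snoc)
      moreover have "mul g (rdiv b h) (u, p) = (\<Sum>i\<le>length p. g (u, take i p) * h (awlast u (take i p), drop i p @ [b]))"
        using True good_drop[OF True] good by (auto simp: mul_apply rdiv_apply intro!: sum.cong)
      moreover have "rdiv b (mul g h) (u, p) = (\<Sum>i\<le>length (p @ [b]). g (u, take i (p @ [b])) * h (awlast u (take i (p @ [b])), drop i (p @ [b])))"
        using good True by (simp add: rdiv_apply mul_apply del: sum.atMost_Suc)
      ultimately show ?thesis unfolding split using good True by (simp add: rdiv_apply)
    next
      case bad
      then have "p \<noteq> []" "last p = a"
        using True arcs(2) ab[of "last p"] good_snoc[of u p b] by auto
      then obtain q where p: "p = q @ [a]" by (metis append_butlast_last_id)
      have "h (awlast u (take i p), drop i p @ [b]) = 0" if "i < length p" for i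
      proof -
        have "drop i p @ [b] = (drop i q @ [a]) @ [b]" using that p by simp
        moreover have "\<not> good (v, (drop i q @ [a]) @ [b])" for v
          using ab[of a] by (subst good_snoc) simp
        ultimately show ?thesis using h by (simp add: normal_def)
      qed
      then have "(\<Sum>i\<le>length p. g (u, take i p) * h (awlast u (take i p), drop i p @ [b]))
        = (\<Sum>i\<in>{length p}. g (u, take i p) * h (awlast u (take i p), drop i p @ [b]))"
        by (intro sum.mono_neutral_right) auto
      then have "mul g (rdiv b h) (u, p) = acoeff b h * g (u, p)"
        using True good_drop[OF True] bad by (auto simp: mul_apply rdiv_apply acoeff_def cong: sum.cong)
      moreover have "mul (rdiv a g) (arr a) (u, p) = g (u, p)"
        using True p by (auto simp: mul_arr_right good_snoc rdiv_apply)
      moreover have "g (u, p @ [b]) = 0" using g bad by (simp add: normal_def)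
      moreover have "rdiv b (mul g h) (u, p) = 0" using bad by (simp add: rdiv_apply mul_apply)
      ultimately show ?thesis using bad True by (simp add: rdiv_apply)
    qed
  qed
qed

section \<open>Cochains given on normal forms\<close>

abbreviation E :: "(('v, 'e) qpath \<Rightarrow> 'k) set set" where
  "E \<equiv> vertex_subring Q I"

definition vertex_supported :: "(('v, 'e) qpath \<Rightarrow> 'k) \<Rightarrow> bool" where
  "vertex_supported e \<longleftrightarrow> normal e \<and> (\<forall>u p. p \<noteq> [] \<longrightarrow> e (u, p) = 0)"

lemma E_carrier: "e \<in> E \<Longrightarrow> e \<in> carrier A"
  and E_nf: "e \<in> E \<Longrightarrow> vertex_supported (nf e)"
  unfolding vertex_subring_def cl_def[symmetric] vertex_supported_def
  by (auto simp: nf_cl) (auto simp: normalize_def)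

lemma A_eqI: "v \<in> carrier A \<Longrightarrow> w \<in> carrier A \<Longrightarrow> nf v = nf w \<Longrightarrow> v = w"
  using nf_inj by blast

lemma eps_add: "eps x (g + h) = eps x g + eps x h"
  and eps_smul: "eps x (smul c g) = c * eps x g"
  by (auto simp: eps_def)

lemma eps_sum: "eps x (\<Sum>a\<in>S. f a) = (\<Sum>a\<in>S. eps x (f a))"
  using sum_comp_morphism[of "eps x" f S] by (simp add: eps_add o_def eps_def)

lemma tuples_append: "us @ vs \<in> tuples A n \<longleftrightarrow>
    set us \<subseteq> carrier A \<and> set vs \<subseteq> carrier A \<and> length us + length vs = n"
  and tuples_Cons: "a # vs \<in> tuples A n \<longleftrightarrow>
    a \<in> carrier A \<and> set vs \<subseteq> carrier A \<and> Suc (length vs) = n"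
  by (auto simp: tuples_def)

lemma faces_in_tuples:
  assumes "vs \<in> tuples A (Suc j)"
  shows "tl vs \<in> tuples A j" "butlast vs \<in> tuples A j" "hd vs \<in> carrier A" "last vs \<in> carrier A"
    "\<And>i. 1 \<le> i \<Longrightarrow> i \<le> j \<Longrightarrow>
       take (i - 1) vs @ [vs ! (i - 1) \<otimes>\<^bsub>A\<^esub> vs ! i] @ drop (i + 1) vs \<in> tuples A j"
proof -
  have l: "length vs = Suc j" and s: "set vs \<subseteq> carrier A" and ne: "vs \<noteq> []"
    using assms by (auto simp: tuples_def)
  show "tl vs \<in> tuples A j" "butlast vs \<in> tuples A j" "hd vs \<in> carrier A" "last vs \<in> carrier A"
    using l s ne by (auto simp: tuples_def dest: list.set_sel in_set_butlastD)
  fix i assume i: "1 \<le> i" "i \<le> j"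
  then have "vs ! (i - 1) \<in> carrier A" "vs ! i \<in> carrier A"
    using s l by (auto intro!: subsetD[OF s] nth_mem)
  then have "vs ! (i - 1) \<otimes>\<^bsub>A\<^esub> vs ! i \<in> carrier A" by simp
  moreover have "set (take (i - 1) vs) \<subseteq> carrier A" "set (drop (i + 1) vs) \<subseteq> carrier A"
    using s set_take_subset set_drop_subset by (meson subset_trans)+
  ultimately show "take (i - 1) vs @ [vs ! (i - 1) \<otimes>\<^bsub>A\<^esub> vs ! i] @ drop (i + 1) vs \<in> tuples A j"
    using i l by (auto simp: tuples_def min_def)
qed

lemma sgnd_closed: "v \<in> carrier A \<Longrightarrow> sgnd A i v \<in> carrier A"
  by (simp add: sgnd_def)

lemma nf_cobd:
  assumes k': "k \<in> tuples A j \<rightarrow> carrier A" and vs: "vs \<in> tuples A (Suc j)"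
  shows "cobd A j k vs \<in> carrier A"
    and "nf (cobd A j k vs) = mul (nf (hd vs)) (nf (k (tl vs)))
      + (\<Sum>i\<in>{1..j}. smul ((-1) ^ i)
           (nf (k (take (i - 1) vs @ [vs ! (i - 1) \<otimes>\<^bsub>A\<^esub> vs ! i] @ drop (i + 1) vs))))
      + smul ((-1) ^ Suc j) (mul (nf (k (butlast vs))) (nf (last vs)))"
proof -
  note c = faces_in_tuples[OF vs] and k = funcset_mem[OF k']
  let ?t = "\<lambda>i. k (take (i - 1) vs @ [vs ! (i - 1) \<otimes>\<^bsub>A\<^esub> vs ! i] @ drop (i + 1) vs)"
  have t: "?t i \<in> carrier A" if "i \<in> {1..j}" for i
    using that by (intro k c(5)) auto
  then have 1: "(\<lambda>i. sgnd A i (?t i)) \<in> {1..j} \<rightarrow> carrier A" by (auto intro!: sgnd_closed)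
  have 2: "hd vs \<otimes>\<^bsub>A\<^esub> k (tl vs) \<in> carrier A" "k (butlast vs) \<otimes>\<^bsub>A\<^esub> last vs \<in> carrier A"
    using k c by auto
  have 3: "(\<Oplus>\<^bsub>A\<^esub>i\<in>{1..j}. sgnd A i (?t i)) \<in> carrier A" by (rule A.finsum_closed[OF 1])
  have 4: "nf (\<Oplus>\<^bsub>A\<^esub>i\<in>{1..j}. sgnd A i (?t i)) = (\<Sum>i\<in>{1..j}. smul ((-1) ^ i) (nf (?t i)))"
    using t by (subst nf_finsum[OF _ 1]) (auto intro!: sum.cong)
  have 5: "cobd A j k vs = hd vs \<otimes>\<^bsub>A\<^esub> k (tl vs) \<oplus>\<^bsub>A\<^esub> (\<Oplus>\<^bsub>A\<^esub>i\<in>{1..j}. sgnd A i (?t i))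
     \<oplus>\<^bsub>A\<^esub> sgnd A (Suc j) (k (butlast vs) \<otimes>\<^bsub>A\<^esub> last vs)"
    using vs by (simp add: cobd_def)
  show "cobd A j k vs \<in> carrier A"
    unfolding 5 using 2 3 by (intro A.a_closed sgnd_closed)
  show "nf (cobd A j k vs) = mul (nf (hd vs)) (nf (k (tl vs)))
      + (\<Sum>i\<in>{1..j}. smul ((-1) ^ i) (nf (?t i)))
      + smul ((-1) ^ Suc j) (mul (nf (k (butlast vs))) (nf (last vs)))"
    unfolding 5 4[symmetric]
    using 2 3 sgnd_closed[OF 2(2), of "Suc j"] nf_mult[OF c(3) k[OF c(1)]]
      nf_mult[OF k[OF c(2)] c(4)]
    by (simp only: nf_add nf_sgnd A.a_closed)
qed

text \<open>Transport of a function on tuples of normal forms to tuples in \<open>A\<close>.\<close>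
definition cochain :: "nat \<Rightarrow> ((('v, 'e) qpath \<Rightarrow> 'k) list \<Rightarrow> ('v, 'e) qpath \<Rightarrow> 'k)
    \<Rightarrow> (('v, 'e) qpath \<Rightarrow> 'k) set list \<Rightarrow> (('v, 'e) qpath \<Rightarrow> 'k) set" where
  "cochain N F = (\<lambda>vs\<in>tuples A N. cl (F (map nf vs)))"

text \<open>Since \<open>cl\<close> and \<open>nf\<close> exchange the operations of \<open>A\<close> with those on normal functions, being a bar
  cocycle in positive degree can be checked on normal functions.\<close>
lemma cochain_in_cocycles:
  assumes N: "N \<ge> 1"
    and closed: "\<And>gs. list_all normal gs \<Longrightarrow> length gs = N \<Longrightarrow> normal (F gs)"
    and add: "\<And>us g h vs. list_all normal (us @ [g, h] @ vs) \<Longrightarrow> length (us @ [g] @ vs) = N \<Longrightarrow>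
      F (us @ [g + h] @ vs) = F (us @ [g] @ vs) + F (us @ [h] @ vs)"
    and balanced: "\<And>us g e h vs. list_all normal (us @ [g, h] @ vs) \<Longrightarrow>
      length (us @ [g, h] @ vs) = N \<Longrightarrow> vertex_supported e \<Longrightarrow>
      F (us @ [mul g e, h] @ vs) = F (us @ [g, mul e h] @ vs)"
    and left: "\<And>e g vs. list_all normal (g # vs) \<Longrightarrow> length (g # vs) = N \<Longrightarrow> vertex_supported e \<Longrightarrow>
      F (mul e g # vs) = mul e (F (g # vs))"
    and right: "\<And>e g vs. list_all normal (vs @ [g]) \<Longrightarrow> length (vs @ [g]) = N \<Longrightarrow> vertex_supported e \<Longrightarrow>
      F (vs @ [mul g e]) = mul (F (vs @ [g])) e"
    and cocycle: "\<And>gs. list_all normal gs \<Longrightarrow> length gs = Suc N \<Longrightarrow>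
      mul (hd gs) (F (tl gs))
      + (\<Sum>i\<in>{1..N}. smul ((-1) ^ i) (F (take (i - 1) gs @ [mul (gs ! (i - 1)) (gs ! i)] @ drop (i + 1) gs)))
      + smul ((-1) ^ Suc N) (mul (F (butlast gs)) (last gs)) = 0"
  shows "cochain N F \<in> cocycles A E N"
proof -
  let ?f = "cochain N F"
  have norm [simp]: "list_all normal (map nf vs)" for vs by (simp add: list_all_iff)
  have val: "?f vs = cl (F (map nf vs))" "?f vs \<in> carrier A" "nf (?f vs) = F (map nf vs)"
    if "vs \<in> tuples A N" for vs
    using that closed[OF norm, of vs] by (simp_all add: cochain_def tuples_def)
  have "is_bimod_hom A E N ?f"
    unfolding is_bimod_hom_def
  proof (intro conjI allI impI; (elim conjE)?)
    show "?f \<in> tuples A N \<rightarrow>\<^sub>E carrier A"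
      using val(2) by (auto simp: cochain_def)
  next
    fix us a b vs assume t: "us @ [a] @ vs \<in> tuples A N" and b: "b \<in> carrier A"
    then have t': "us @ [b] @ vs \<in> tuples A N" "us @ [a \<oplus>\<^bsub>A\<^esub> b] @ vs \<in> tuples A N" "a \<in> carrier A"
      by (auto simp: tuples_append tuples_def)
    show "?f (us @ [a \<oplus>\<^bsub>A\<^esub> b] @ vs) = ?f (us @ [a] @ vs) \<oplus>\<^bsub>A\<^esub> ?f (us @ [b] @ vs)"
      using val[OF t] val[OF t'(1)] val[OF t'(2)] t' b t
        add[of "map nf us" "nf a" "nf b" "map nf vs"]
      by (intro A_eqI) (auto simp: tuples_def)
  next
    fix us a e b vs assume t: "us @ [a, b] @ vs \<in> tuples A N" and e: "e \<in> E"
    then have t': "us @ [a \<otimes>\<^bsub>A\<^esub> e, b] @ vs \<in> tuples A N" "us @ [a, e \<otimes>\<^bsub>A\<^esub> b] @ vs \<in> tuples A N"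
      "a \<in> carrier A" "b \<in> carrier A"
      using E_carrier[OF e] by (auto simp: tuples_append tuples_def)
    show "?f (us @ [a \<otimes>\<^bsub>A\<^esub> e, b] @ vs) = ?f (us @ [a, e \<otimes>\<^bsub>A\<^esub> b] @ vs)"
      using val[OF t'(1)] val[OF t'(2)] t' t E_carrier[OF e]
        balanced[of "map nf us" "nf a" "nf b" "map nf vs", OF _ _ E_nf[OF e]]
      by (intro A_eqI) (auto simp: tuples_def)
  next
    fix e a vs assume t: "a # vs \<in> tuples A N" and e: "e \<in> E"
    then have t': "(e \<otimes>\<^bsub>A\<^esub> a) # vs \<in> tuples A N" "a \<in> carrier A"
      using E_carrier[OF e] by (auto simp: tuples_Cons)
    show "?f ((e \<otimes>\<^bsub>A\<^esub> a) # vs) = e \<otimes>\<^bsub>A\<^esub> ?f (a # vs)"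
      using val[OF t'(1)] val[OF t] t' t E_carrier[OF e]
        left[of "nf a" "map nf vs", OF _ _ E_nf[OF e]]
      by (intro A_eqI) (auto simp: tuples_def)
  next
    fix e a vs assume t: "vs @ [a] \<in> tuples A N" and e: "e \<in> E"
    then have t': "vs @ [a \<otimes>\<^bsub>A\<^esub> e] \<in> tuples A N" "a \<in> carrier A"
      using E_carrier[OF e] by (auto simp: tuples_append)
    show "?f (vs @ [a \<otimes>\<^bsub>A\<^esub> e]) = ?f (vs @ [a]) \<otimes>\<^bsub>A\<^esub> e"
      using val[OF t'(1)] val[OF t] t' t E_carrier[OF e]
        right[of "map nf vs" "nf a", OF _ _ E_nf[OF e]]
      by (intro A_eqI) (auto simp: tuples_def)
  qed (use N in auto)
  moreover have "cobd A N ?f vs = \<zero>\<^bsub>A\<^esub>" if vs: "vs \<in> tuples A (Suc N)" for vs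
  proof -
    have l: "length vs = Suc N" "set vs \<subseteq> carrier A" "vs \<noteq> []" using vs by (auto simp: tuples_def)
    note c = faces_in_tuples[OF vs]
    have f: "?f \<in> tuples A N \<rightarrow> carrier A" using val(2) by blast
    note d = nf_cobd[OF f vs]
    have inner: "nf (?f (take (i - 1) vs @ [vs ! (i - 1) \<otimes>\<^bsub>A\<^esub> vs ! i] @ drop (i + 1) vs)) =
       F (take (i - 1) (map nf vs) @ [mul (map nf vs ! (i - 1)) (map nf vs ! i)] @ drop (i + 1) (map nf vs))"
      if i: "i \<in> {1..N}" for i
    proof -
      have "vs ! (i - 1) \<in> carrier A" "vs ! i \<in> carrier A"
        using i l by (auto intro!: subsetD[OF l(2)] nth_mem)
      then show ?thesis
        using i l c(5)[of i] by (subst val(3)) (auto simp: take_map drop_map)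
    qed
    have "(\<Sum>i\<in>{1..N}. smul ((-1) ^ i)
          (nf (?f (take (i - 1) vs @ [vs ! (i - 1) \<otimes>\<^bsub>A\<^esub> vs ! i] @ drop (i + 1) vs))))
      = (\<Sum>i\<in>{1..N}. smul ((-1) ^ i) (F (take (i - 1) (map nf vs)
          @ [mul (map nf vs ! (i - 1)) (map nf vs ! i)] @ drop (i + 1) (map nf vs))))"
      by (intro sum.cong refl) (simp only: inner)
    moreover have "nf (?f (tl vs)) = F (tl (map nf vs))" "nf (?f (butlast vs)) = F (butlast (map nf vs))"
      "nf (hd vs) = hd (map nf vs)" "nf (last vs) = last (map nf vs)"
      using l val(3)[OF c(1)] val(3)[OF c(2)] by (simp_all add: map_tl map_butlast hd_map last_map)
    ultimately have "nf (cobd A N ?f vs) = 0"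
      unfolding d(2) using cocycle[OF norm, of vs] l by (simp only: length_map)
    then show ?thesis using d(1) by (intro A_eqI) auto
  qed
  then have "cobd A N ?f = (\<lambda>vs\<in>tuples A (Suc N). \<zero>\<^bsub>A\<^esub>)"
    by (auto simp: fun_eq_iff cobd_def)
  ultimately show ?thesis
    by (simp add: cocycles_def kernel_def cochains_def)
qed

section \<open>Detecting non-zero cup products\<close>

lemma bimod_hom_closed: "is_bimod_hom A E j k \<Longrightarrow> vs \<in> tuples A j \<Longrightarrow> k vs \<in> carrier A"
  unfolding is_bimod_hom_def by (elim conjE) (rule PiE_mem)

lemma zero_is_bimod_hom: "is_bimod_hom A E j (\<lambda>vs\<in>tuples A j. \<zero>\<^bsub>A\<^esub>)"
  unfolding is_bimod_hom_def
  by (auto simp: tuples_append tuples_Cons tuples_def[of A 0] E_carrier)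

text \<open>The zero cochain lets a cocycle be recovered as an element of its own class, so that vanishing of
  a product of classes can be tested on chosen representatives.\<close>
lemma zero_in_coboundaries:
  assumes "n \<ge> 1"
  shows "(\<lambda>vs\<in>tuples A n. \<zero>\<^bsub>A\<^esub>) \<in> coboundaries A E n"
proof -
  obtain j where n: "n = Suc j" using assms by (cases n) auto
  let ?z = "\<lambda>vs\<in>tuples A j. \<zero>\<^bsub>A\<^esub>"
  have "cobd A j ?z vs = \<zero>\<^bsub>A\<^esub>" if vs: "vs \<in> tuples A (Suc j)" for vs
  proof -
    have "nf (cobd A j ?z vs) = 0"
      using faces_in_tuples[OF vs]
      by (subst nf_cobd(2)[OF _ vs]) (auto intro!: sum.neutral)
    then show ?thesis using nf_cobd(1)[OF _ vs, of ?z] by (intro A_eqI) auto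
  qed
  then have "cobd A j ?z = (\<lambda>vs\<in>tuples A (Suc j). \<zero>\<^bsub>A\<^esub>)"
    by (auto simp: fun_eq_iff cobd_def)
  then show ?thesis
    using zero_is_bimod_hom[of j] unfolding n coboundaries_def
    by (force simp: cochains_def)
qed

lemma bimod_hom_zero_entry:
  assumes k: "is_bimod_hom A E j k" and t: "us @ [\<zero>\<^bsub>A\<^esub>] @ vs \<in> tuples A j"
  shows "k (us @ [\<zero>\<^bsub>A\<^esub>] @ vs) = \<zero>\<^bsub>A\<^esub>"
proof -
  have c: "k (us @ [\<zero>\<^bsub>A\<^esub>] @ vs) \<in> carrier A"
    using k t by (rule bimod_hom_closed)
  have "k (us @ [\<zero>\<^bsub>A\<^esub> \<oplus>\<^bsub>A\<^esub> \<zero>\<^bsub>A\<^esub>] @ vs) = k (us @ [\<zero>\<^bsub>A\<^esub>] @ vs) \<oplus>\<^bsub>A\<^esub> k (us @ [\<zero>\<^bsub>A\<^esub>] @ vs)"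
  proof -
    have "\<forall>us a b vs. us @ [a] @ vs \<in> tuples A j \<and> b \<in> carrier A \<longrightarrow>
        k (us @ [a \<oplus>\<^bsub>A\<^esub> b] @ vs) = k (us @ [a] @ vs) \<oplus>\<^bsub>A\<^esub> k (us @ [b] @ vs)"
      by (rule k[unfolded is_bimod_hom_def, THEN conjunct2, THEN conjunct1])
    with t show ?thesis by blast
  qed
  then show ?thesis using c by simp
qed

text \<open>The inner terms of the coboundary vanish since they contain a zero entry, and the outer terms
  since taking the coefficient at a vertex is multiplicative.\<close>
lemma coboundary_eps_zero:
  assumes k: "is_bimod_hom A E j k" and ts: "ts \<in> tuples A (Suc j)" and x: "x \<in> verts Q"
    and prod: "\<And>i. i < j \<Longrightarrow> ts ! i \<otimes>\<^bsub>A\<^esub> ts ! Suc i = \<zero>\<^bsub>A\<^esub>"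
    and rad: "\<And>t. t \<in> set ts \<Longrightarrow> eps x (nf t) = 0"
  shows "eps x (nf (cobd A j k ts)) = 0"
proof -
  have kc: "k \<in> tuples A j \<rightarrow> carrier A"
    using bimod_hom_closed[OF k] by blast
  have ne: "ts \<noteq> []" using ts by (auto simp: tuples_def)
  have 1: "k (take (i - 1) ts @ [ts ! (i - 1) \<otimes>\<^bsub>A\<^esub> ts ! i] @ drop (i + 1) ts) = \<zero>\<^bsub>A\<^esub>"
    if i: "i \<in> {1..j}" for i
  proof -
    have "ts ! (i - 1) \<otimes>\<^bsub>A\<^esub> ts ! i = \<zero>\<^bsub>A\<^esub>" using prod[of "i - 1"] i by auto
    then show ?thesis using faces_in_tuples(5)[OF ts, of i] i
      by (simp only:) (intro bimod_hom_zero_entry[OF k], auto)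
  qed
  have 2: "(\<Sum>i\<in>{1..j}. smul ((-1) ^ i)
      (nf (k (take (i - 1) ts @ [ts ! (i - 1) \<otimes>\<^bsub>A\<^esub> ts ! i] @ drop (i + 1) ts)))) = 0"
    by (intro sum.neutral ballI) (simp only: 1 nf_zero smul_zero)
  show ?thesis
    using ne rad[of "hd ts"] rad[of "last ts"]
    unfolding nf_cobd(2)[OF kc ts] 2
    by (simp add: eps_add eps_smul eps_mul[OF x] del: power_Suc)
qed

text \<open>The cup product of the two representatives has a nonzero vertex coefficient on \<open>ts\<close>, which no
  coboundary has.\<close>
lemma cup_nonzeroI:
  assumes f: "f \<in> cocycles A E n" and g: "g \<in> cocycles A E m" and nm: "n \<ge> 1" "m \<ge> 1"
    and ts: "ts \<in> tuples A (n + m)" and x: "x \<in> verts Q"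
    and prod: "\<And>i. Suc i < n + m \<Longrightarrow> ts ! i \<otimes>\<^bsub>A\<^esub> ts ! Suc i = \<zero>\<^bsub>A\<^esub>"
    and rad: "\<And>t. t \<in> set ts \<Longrightarrow> eps x (nf t) = 0"
    and fx: "eps x (nf (f (take n ts))) \<noteq> 0" and gx: "eps x (nf (g (drop n ts))) \<noteq> 0"
  shows "cup_nonzero A E n m"
proof -
  have bf: "is_bimod_hom A E n f" and bg: "is_bimod_hom A E m g"
    using f g by (auto simp: cocycles_def kernel_def cochains_def)
  note carr = bimod_hom_closed
  define cls where "cls = (\<lambda>j h. coboundaries A E j #>\<^bsub>(cochains A E j)\<lparr>carrier := cocycles A E j\<rparr>\<^esub> h)"
  have rep: "h \<in> cls j h" if h: "is_bimod_hom A E j h" and j: "j \<ge> 1" for h j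
  proof -
    have "h = mult (cochains A E j) (\<lambda>vs\<in>tuples A j. \<zero>\<^bsub>A\<^esub>) h"
      using h carr[OF h] by (auto simp: cochains_def is_bimod_hom_def fun_eq_iff PiE_def extensional_def)
    then show ?thesis using zero_in_coboundaries[OF j] unfolding cls_def r_coset_def by auto
  qed
  have "cls n f \<in> carrier (HH A E n)" "cls m g \<in> carrier (HH A E m)"
    using f g by (auto simp: HH_def FactGroup_def RCOSETS_def cls_def)
  moreover have "cup A E n m (cls n f) (cls m g) \<noteq> \<one>\<^bsub>HH A E (n + m)\<^esub>"
  proof
    assume "cup A E n m (cls n f) (cls m g) = \<one>\<^bsub>HH A E (n + m)\<^esub>"
    then have eq: "cup A E n m (cls n f) (cls m g) = coboundaries A E (n + m)"
      by (simp add: HH_def FactGroup_def)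
    let ?c = "cup_cochain A n m f g"
    have tt: "take n ts \<in> tuples A n" "drop n ts \<in> tuples A m"
      using ts by (auto simp: tuples_def dest: in_set_takeD in_set_dropD)
    have cval: "?c vs \<in> carrier A" if "vs \<in> tuples A (n + m)" for vs
    proof -
      have "take n vs \<in> tuples A n" "drop n vs \<in> tuples A m"
        using that by (auto simp: tuples_def dest: in_set_takeD in_set_dropD)
      with that show ?thesis using carr[OF bf] carr[OF bg] by (simp add: cup_cochain_def)
    qed
    have "?c = mult (cochains A E (n + m)) (\<lambda>vs\<in>tuples A (n + m). \<zero>\<^bsub>A\<^esub>) ?c"
    proof (rule ext)
      fix vs
      show "?c vs = mult (cochains A E (n + m)) (\<lambda>vs\<in>tuples A (n + m). \<zero>\<^bsub>A\<^esub>) ?c vs"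
        using cval[of vs] by (cases "vs \<in> tuples A (n + m)") (auto simp: cochains_def cup_cochain_def)
    qed
    then have "?c \<in> coboundaries A E (n + m) #>\<^bsub>cochains A E (n + m)\<^esub> ?c"
      using zero_in_coboundaries[of "n + m"] nm unfolding r_coset_def by auto
    then have "?c \<in> cup A E n m (cls n f) (cls m g)"
      unfolding cup_def using rep[OF bf nm(1)] rep[OF bg nm(2)] by blast
    then have "?c \<in> coboundaries A E (n + m)" by (simp only: eq)
    moreover obtain j where j: "n + m = Suc j" using nm by (cases "n + m") auto
    ultimately obtain k where k: "is_bimod_hom A E j k" "?c = cobd A j k"
      by (auto simp: coboundaries_def cochains_def)
    have "eps x (nf (?c ts)) = 0"
      unfolding k(2) using ts prod rad x j by (intro coboundary_eps_zero[OF k(1)]) auto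
    moreover have "eps x (nf (?c ts)) = eps x (nf (f (take n ts))) * eps x (nf (g (drop n ts)))"
      using ts tt carr[OF bf] carr[OF bg] by (simp add: cup_cochain_def eps_mul[OF x])
    ultimately show False using fx gx by simp
  qed
  ultimately show ?thesis unfolding cup_nonzero_def by blast
qed

section \<open>Multiplication by vertices\<close>

text \<open>From here on normal forms are added and scaled as elements of a vector space; evaluation at a
  path is only unfolded where a comparison of coefficients is intended.\<close>
lemmas pointwise = plus_fun_apply zero_fun_apply minus_apply uminus_apply smul_apply

declare pointwise [simp del]

lemma mul_vertex_left:
  assumes "vertex_supported e" "good (u, p)"
  shows "mul e h (u, p) = e (u, []) * h (u, p)"
proof -
  have "mul e h (u, p) = (\<Sum>i\<le>length p. e (u, take i p) * h (awlast u (take i p), drop i p))"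
    using assms by (simp add: mul_apply)
  also have "\<dots> = (\<Sum>i\<in>{0}. e (u, take i p) * h (awlast u (take i p), drop i p))"
  proof (rule sum.mono_neutral_right)
    have "e (u, take i p) = 0" if "i \<le> length p" "i \<noteq> 0" for i
      using that assms(1) by (cases p) (auto simp: vertex_supported_def)
    then show "\<forall>i\<in>{..length p} - {0}. e (u, take i p) * h (awlast u (take i p), drop i p) = 0"
      by auto
  qed auto
  finally show ?thesis by simp
qed

lemma mul_vertex_right:
  assumes "vertex_supported e" "good (u, p)"
  shows "mul h e (u, p) = h (u, p) * e (awlast u p, [])"
proof -
  have "mul h e (u, p) = (\<Sum>i\<le>length p. h (u, take i p) * e (awlast u (take i p), drop i p))"
    using assms by (simp add: mul_apply)
  also have "\<dots> = (\<Sum>i\<in>{length p}. h (u, take i p) * e (awlast u (take i p), drop i p))"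
    by (rule sum.mono_neutral_right) (use assms(1) in \<open>auto simp: vertex_supported_def\<close>)
  finally show ?thesis by simp
qed

lemma vertex_supported_normal [simp]: "vertex_supported e \<Longrightarrow> normal e"
  by (simp add: vertex_supported_def)

lemma div_vertex_zero [simp]:
  assumes "vertex_supported e"
  shows "ldiv a e = 0" "rdiv a e = 0" "acoeff a e = 0"
  using assms by (auto simp: fun_eq_iff pointwise ldiv_apply rdiv_apply acoeff_def vertex_supported_def)

lemma normal_eqI: "normal g \<Longrightarrow> normal h \<Longrightarrow> (\<And>u p. good (u, p) \<Longrightarrow> g (u, p) = h (u, p)) \<Longrightarrow> g = h"
  unfolding normal_def fun_eq_iff by (metis surj_pair)

end

section \<open>The cocycle of a gentle cycle\<close>

text \<open>The set \<open>C\<close> of arrows of the cycle with its successor function replaces the cycle itself.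
  A word that runs through its set of arrows several times would otherwise count each
  arrow repeatedly.\<close>
locale gentle_cycle = monomial_quotient Q I P
  for Q :: "('v, 'e) pre_digraph"
    and I :: "(('v, 'e) qpath \<Rightarrow> 'k :: field) set"
    and P :: "('v, 'e) qpath set" +
  fixes C :: "'e set" and \<sigma> :: "'e \<Rightarrow> 'e"
  assumes finite_C: "finite C"
    and \<sigma>_in_C: "a \<in> C \<Longrightarrow> \<sigma> a \<in> C"
    and successor: "a \<in> C \<Longrightarrow> arrows_in Q I a b \<longleftrightarrow> b = \<sigma> a"
    and predecessor: "a \<in> C \<Longrightarrow> arrows_in Q I c (\<sigma> a) \<longleftrightarrow> c = a"
    and unique_continuation: "arrows_notin Q I c b \<Longrightarrow> arrows_notin Q I c b' \<Longrightarrow> b = b'"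
begin

lemma C_arcs: "a \<in> C \<Longrightarrow> a \<in> arcs Q"
  and head_C: "a \<in> C \<Longrightarrow> head Q a = tail Q (\<sigma> a)"
  using successor[of a "\<sigma> a"] by (auto simp: arrows_in_def)

lemma ldiv_mul_cycle:
  assumes "a \<in> C" "normal g" "normal h"
  shows "ldiv a (mul g h) = mul (ldiv a g) h + smul (eps (tail Q a) g) (ldiv a h)
           - smul (acoeff a g) (mul (arr (\<sigma> a)) (ldiv (\<sigma> a) h))"
  by (rule ldiv_mul) (use assms successor in auto)

lemma rdiv_mul_cycle:
  assumes "a \<in> C" "normal g" "normal h"
  shows "rdiv (\<sigma> a) (mul g h) = mul g (rdiv (\<sigma> a) h) + smul (eps (head Q (\<sigma> a)) h) (rdiv (\<sigma> a) g)
           - smul (acoeff (\<sigma> a) h) (mul (rdiv a g) (arr a))"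
  by (rule rdiv_mul) (use assms predecessor in auto)

lemma acoeff_mul_cycle:
  "a \<in> C \<Longrightarrow> acoeff a (mul g h) = eps (tail Q a) g * acoeff a h + acoeff a g * eps (head Q a) h"
  by (rule acoeff_mul) (rule C_arcs)

text \<open>For \<open>[v\<^sub>1, \<dots>, v\<^sub>m]\<close> this is \<open>c\<^sub>a(v\<^sub>1) c\<^bsub>\<sigma> a\<^esub>(v\<^sub>2) \<dots> (\<sigma>\<^bsup>m-1\<^esup> a \ v\<^sub>m)\<close>, with \<open>c\<^sub>b\<close> the coefficient of the
  arrow \<open>b\<close>. It carries the recursion in the cocycle identity.\<close>
fun tail_cochain :: "'e \<Rightarrow> (('v, 'e) qpath \<Rightarrow> 'k) list \<Rightarrow> ('v, 'e) qpath \<Rightarrow> 'k" where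
  "tail_cochain a [] = 0"
| "tail_cochain a [g] = ldiv a g"
| "tail_cochain a (g # h # gs) = smul (acoeff a g) (tail_cochain (\<sigma> a) (h # gs))"

lemma tail_cochain_Cons:
  "gs \<noteq> [] \<Longrightarrow> tail_cochain a (g # gs) = smul (acoeff a g) (tail_cochain (\<sigma> a) gs)"
  by (cases gs) auto

lemma normal_tail_cochain [simp]: "normal (tail_cochain a gs)"
  by (induction a gs rule: tail_cochain.induct) auto

lemma tail_cochain_add:
  "tail_cochain a (us @ [g + h] @ vs) = tail_cochain a (us @ [g] @ vs) + tail_cochain a (us @ [h] @ vs)"
proof (induction us arbitrary: a)
  case Nil
  then show ?case
    by (cases vs) (auto simp: ldiv_add acoeff_add smul_add_scalar)
qed (simp add: tail_cochain_Cons smul_add)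

lemma tail_cochain_left:
  assumes "vertex_supported e" "normal g" "a \<in> C"
  shows "tail_cochain a (mul e g # gs) = smul (eps (tail Q a) e) (tail_cochain a (g # gs))"
  using assms
  by (cases gs) (auto simp: ldiv_mul_cycle acoeff_mul_cycle)

lemma tail_cochain_balanced:
  assumes "vertex_supported e" "list_all normal (us @ [g, h] @ vs)" "a \<in> C"
  shows "tail_cochain a (us @ [mul g e, h] @ vs) = tail_cochain a (us @ [g, mul e h] @ vs)"
  using assms
proof (induction us arbitrary: a)
  case Nil
  then show ?case
    by (simp add: tail_cochain_left \<sigma>_in_C acoeff_mul_cycle head_C mult.commute)
next
  case (Cons u us)
  then show ?case by (simp add: tail_cochain_Cons \<sigma>_in_C)
qed

lemma tail_cochain_right:
  assumes "vertex_supported e" "list_all normal (us @ [g])" "a \<in> C"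
  shows "tail_cochain a (us @ [mul g e]) = mul (tail_cochain a (us @ [g])) e"
  using assms
  by (induction us arbitrary: a)
    (auto simp: ldiv_mul_cycle tail_cochain_Cons \<sigma>_in_C mul_smul_left)

text \<open>The \<open>i\<close>-th inner face of the bar complex, with \<open>i\<close> counted from 1 as in the coboundary.\<close>
definition merge :: "nat \<Rightarrow> (('v, 'e) qpath \<Rightarrow> 'k) list \<Rightarrow> (('v, 'e) qpath \<Rightarrow> 'k) list" where
  "merge i gs = take (i - 1) gs @ [mul (gs ! (i - 1)) (gs ! i)] @ drop (i + 1) gs"

lemma merge_1: "merge 1 (g # h # gs) = mul g h # gs"
  and merge_Suc: "i \<ge> 1 \<Longrightarrow> merge (Suc i) (g # gs) = g # merge i gs"
  and merge_ne [simp]: "merge i gs \<noteq> []"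
  by (cases i; simp add: merge_def)+

lemma sum_shift_one:
  fixes f :: "nat \<Rightarrow> 'a :: comm_monoid_add"
  shows "(\<Sum>i\<in>{1..Suc n}. f i) = f 1 + (\<Sum>i\<in>{1..n}. f (Suc i))"
  using sum.atLeast_Suc_atMost[of 1 "Suc n" f] sum.shift_bounds_cl_Suc_ivl[of f 1 n] by simp

text \<open>The Leibniz rule for the coefficient of an arrow produces, at each inner position, two terms of
  the same shape, and neighbouring positions cancel. What is left is the first term of
  the first position and the correction in the Leibniz rule for \<open>ldiv\<close> at the last one.\<close>
lemma tail_cochain_coboundary:
  assumes "a \<in> C" "list_all normal gs" "length gs = Suc (Suc m)"
  shows "(\<Sum>i\<in>{1..Suc m}. smul ((-1) ^ i) (tail_cochain a (merge i gs)))
      + smul ((-1) ^ Suc (Suc m)) (mul (tail_cochain a (butlast gs)) (last gs))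
    = - smul (eps (tail Q a) (hd gs)) (tail_cochain a (tl gs))
      - smul ((-1) ^ Suc m) (mul (arr ((\<sigma> ^^ Suc m) a)) (tail_cochain a gs))"
  using assms
proof (induction m arbitrary: a gs)
  case 0
  then obtain g h where gs: "gs = [g, h]"
    by (auto simp: length_Suc_conv)
  with 0 show ?case
    by (simp add: merge_def ldiv_mul_cycle mul_smul_right smul_minus_scalar)
next
  case (Suc m)
  then obtain g h ks where gs: "gs = g # h # ks" and l: "length ks = Suc m"
    by (auto simp: length_Suc_conv)
  then have ks: "ks \<noteq> []" by auto
  have n: "list_all normal (h # ks)" "\<sigma> a \<in> C" using Suc.prems gs \<sigma>_in_C by auto
  let ?c = "acoeff a g"
  let ?S = "\<Sum>i\<in>{1..Suc m}. smul ((-1) ^ i) (tail_cochain (\<sigma> a) (merge i (h # ks)))"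
  let ?X = "mul (tail_cochain (\<sigma> a) (h # butlast ks)) (last ks)"
  let ?T = "tail_cochain (\<sigma> a) ks"
  let ?U = "mul (arr ((\<sigma> ^^ Suc m) (\<sigma> a))) (tail_cochain (\<sigma> a) (h # ks))"
  have "?S + smul ((-1) ^ Suc (Suc m)) ?X = - smul (eps (tail Q (\<sigma> a)) h) ?T - smul ((-1) ^ Suc m) ?U"
    using Suc.IH[OF n(2,1)] l ks by simp
  then have S: "?S = - smul (eps (tail Q (\<sigma> a)) h) ?T - smul ((-1) ^ Suc m) ?U - smul ((-1) ^ Suc (Suc m)) ?X"
    by (simp only: eq_diff_eq)
  have "(\<Sum>i\<in>{1..Suc (Suc m)}. smul ((-1) ^ i) (tail_cochain a (merge i gs)))
    = - tail_cochain a (mul g h # ks)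
      + (\<Sum>i\<in>{1..Suc m}. smul ((-1) ^ Suc i) (tail_cochain a (merge (Suc i) gs)))"
    unfolding sum_shift_one[of _ "Suc m"] by (simp add: gs merge_1[simplified] smul_minus_scalar)
  also have "(\<Sum>i\<in>{1..Suc m}. smul ((-1) ^ Suc i) (tail_cochain a (merge (Suc i) gs))) = smul (- ?c) ?S"
    unfolding smul_sum by (rule sum.cong) (auto simp: gs merge_Suc tail_cochain_Cons mult.commute)
  finally have 1: "(\<Sum>i\<in>{1..Suc (Suc m)}. smul ((-1) ^ i) (tail_cochain a (merge i gs)))
    = - tail_cochain a (mul g h # ks) + smul (- ?c) ?S" .
  have 2: "tail_cochain a (mul g h # ks) = smul (eps (tail Q a) g * acoeff a h + ?c * eps (tail Q (\<sigma> a)) h) ?T"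
    using ks Suc.prems by (simp add: tail_cochain_Cons acoeff_mul_cycle head_C)
  have 3: "tail_cochain a (butlast gs) = smul ?c (tail_cochain (\<sigma> a) (h # butlast ks))" "last gs = last ks"
    using ks by (auto simp: gs tail_cochain_Cons)
  have 4: "tail_cochain a (tl gs) = smul (acoeff a h) ?T" "hd gs = g"
    using ks by (auto simp: gs tail_cochain_Cons)
  have 5: "mul (arr ((\<sigma> ^^ Suc (Suc m)) a)) (tail_cochain a gs) = smul ?c ?U"
    by (simp add: gs mul_smul_right funpow_swap1)
  show ?case
    unfolding 1 S 2 3 4 5 mul_smul_left by (simp add: fun_eq_iff pointwise algebra_simps)
qed

definition cycle_cochain :: "(('v, 'e) qpath \<Rightarrow> 'k) list \<Rightarrow> ('v, 'e) qpath \<Rightarrow> 'k" where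
  "cycle_cochain gs = (\<Sum>a\<in>C. mul (rdiv a (hd gs)) (tail_cochain (\<sigma> a) (tl gs)))"

text \<open>The face that multiplies the first two entries contributes, besides the terms that cancel,
  the correction of \<open>rdiv_mul\<close>. It has the shape \<open>Z(b) = (v / b) b c\<^bsub>\<sigma> b\<^esub>(w) \<dots>\<close> with \<open>b\<close> the
  predecessor of the arrow in question. The
  correction of \<open>tail_cochain_coboundary\<close> is \<open>Z(a)\<close> with the sign \<open>(-1)\<^bsup>N-1\<^esup> = -1\<close>, because
  \<open>\<sigma>\<^sup>N = id\<close>. Summed over the cycle the two cancel.\<close>
lemma cycle_cochain_cocycle:
  assumes N: "N \<ge> 2" and period: "\<And>a. a \<in> C \<Longrightarrow> (\<sigma> ^^ N) a = a" and sign: "(-1 :: 'k) ^ N = 1"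
    and gs: "list_all normal gs" "length gs = Suc N"
  shows "mul (hd gs) (cycle_cochain (tl gs))
      + (\<Sum>i\<in>{1..N}. smul ((-1) ^ i) (cycle_cochain (merge i gs)))
      + smul ((-1) ^ Suc N) (mul (cycle_cochain (butlast gs)) (last gs)) = 0"
proof -
  obtain m where m: "N = Suc (Suc m)" using N by (auto dest!: le_Suc_ex)
  obtain v w vs where gsv: "gs = v # w # vs" and l: "length vs = Suc m"
    using gs m by (auto simp: length_Suc_conv)
  have vs: "vs \<noteq> []" using l by auto
  have nv: "normal v" "normal w" "list_all normal (w # vs)" using gs gsv by auto
  have inj: "inj_on \<sigma> C"
    by (rule inj_onI) (metis period funpow_swap1 m funpow.simps(2) comp_apply)
  have img: "\<sigma> ` C = C"
    using \<sigma>_in_C endo_inj_surj[OF finite_C _ inj] by blast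
  have bij: "bij_betw \<sigma> C C" using inj img by (simp add: bij_betw_def)
  let ?T = "\<lambda>a. tail_cochain (\<sigma> a) vs"
  let ?Z = "\<lambda>b. mul (mul (rdiv b v) (arr b)) (tail_cochain (\<sigma> b) (w # vs))"
  let ?S = "\<lambda>a. \<Sum>i\<in>{1..Suc m}. smul ((-1) ^ i) (tail_cochain (\<sigma> a) (merge i (w # vs)))"
  let ?X = "\<lambda>a. mul (tail_cochain (\<sigma> a) (w # butlast vs)) (last vs)"
  have S: "?S a = - smul (eps (head Q a) w) (?T a) + mul (arr a) (tail_cochain (\<sigma> a) (w # vs)) - ?X a"
    if a: "a \<in> C" for a
  proof -
    have "?S a + smul ((-1) ^ Suc (Suc m)) (?X a)
      = - smul (eps (tail Q (\<sigma> a)) w) (?T a) - smul ((-1) ^ Suc m) (mul (arr ((\<sigma> ^^ Suc m) (\<sigma> a))) (tail_cochain (\<sigma> a) (w # vs)))"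
      using tail_cochain_coboundary[OF \<sigma>_in_C[OF a] nv(3), of m] l vs by simp
    moreover have "(\<sigma> ^^ Suc m) (\<sigma> a) = a" using period[OF a] unfolding m by (simp add: funpow_swap1)
    moreover have "(-1 :: 'k) ^ Suc m = -1" using sign unfolding m by (metis minus_minus mult_minus1 power_Suc)
    ultimately show ?thesis using sign m head_C[OF a] by (simp add: smul_minus_scalar eq_diff_eq)
  qed
  have 1: "mul v (cycle_cochain (w # vs)) = (\<Sum>a\<in>C. mul (mul v (rdiv a w)) (?T a))"
    by (simp add: cycle_cochain_def mul_sum_right mul_assoc)
  have 2: "(\<Sum>i\<in>{1..N}. smul ((-1) ^ i) (cycle_cochain (merge i gs)))
      = - (\<Sum>a\<in>C. mul (rdiv a (mul v w)) (?T a)) - (\<Sum>a\<in>C. mul (rdiv a v) (?S a))"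
  proof -
    have "(\<Sum>i\<in>{1..N}. smul ((-1) ^ i) (cycle_cochain (merge i gs)))
      = - cycle_cochain (mul v w # vs) + (\<Sum>i\<in>{1..Suc m}. smul ((-1) ^ Suc i) (cycle_cochain (merge (Suc i) gs)))"
      unfolding m sum_shift_one[of _ "Suc m"] by (simp add: gsv merge_1[simplified] smul_minus_scalar)
    also have "(\<Sum>i\<in>{1..Suc m}. smul ((-1) ^ Suc i) (cycle_cochain (merge (Suc i) gs)))
      = (\<Sum>i\<in>{1..Suc m}. \<Sum>a\<in>C. mul (rdiv a v) (smul (- ((-1) ^ i)) (tail_cochain (\<sigma> a) (merge i (w # vs)))))"
      by (rule sum.cong) (auto simp: gsv merge_Suc cycle_cochain_def smul_sum mul_smul_right)
    also have "\<dots> = (\<Sum>a\<in>C. \<Sum>i\<in>{1..Suc m}. mul (rdiv a v) (smul (- ((-1) ^ i)) (tail_cochain (\<sigma> a) (merge i (w # vs)))))"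
      by (rule sum.swap)
    also have "\<dots> = - (\<Sum>a\<in>C. mul (rdiv a v) (?S a))"
      by (simp only: smul_minus_scalar mul_minus_right sum_negf mul_sum_right)
    also have "cycle_cochain (mul v w # vs) = (\<Sum>a\<in>C. mul (rdiv a (mul v w)) (?T a))"
      by (simp add: cycle_cochain_def)
    finally show ?thesis by simp
  qed
  have 3: "mul (cycle_cochain (butlast gs)) (last gs) = (\<Sum>a\<in>C. mul (rdiv a v) (?X a))"
    using vs by (simp add: gsv cycle_cochain_def mul_sum_left mul_assoc)
  \<comment> \<open>Indexed by the predecessor \<open>b\<close>, so that the correction in the Leibniz rule refers to an
    arrow of the cycle.\<close>
  have Z: "mul (mul v (rdiv (\<sigma> b) w)) (?T (\<sigma> b)) - mul (rdiv (\<sigma> b) (mul v w)) (?T (\<sigma> b))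
       - mul (rdiv (\<sigma> b) v) (?S (\<sigma> b)) - mul (rdiv (\<sigma> b) v) (?X (\<sigma> b)) = ?Z b - ?Z (\<sigma> b)"
    if b: "b \<in> C" for b
    unfolding S[OF \<sigma>_in_C[OF b]] rdiv_mul_cycle[OF b nv(1,2)] using vs
    by (simp add: mul_add_left mul_add_right mul_diff_left mul_diff_right mul_minus_left
        mul_minus_right mul_smul_left mul_smul_right mul_assoc tail_cochain_Cons)
  have "mul (hd gs) (cycle_cochain (tl gs))
      + (\<Sum>i\<in>{1..N}. smul ((-1) ^ i) (cycle_cochain (merge i gs)))
      + smul ((-1) ^ Suc N) (mul (cycle_cochain (butlast gs)) (last gs))
    = (\<Sum>a\<in>C. mul (mul v (rdiv a w)) (?T a) - mul (rdiv a (mul v w)) (?T a)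
       - mul (rdiv a v) (?S a) - mul (rdiv a v) (?X a))"
    unfolding 2 3 using sign by (simp add: gsv 1 smul_minus_scalar sum_subtractf)
  also have "\<dots> = (\<Sum>b\<in>C. mul (mul v (rdiv (\<sigma> b) w)) (?T (\<sigma> b)) - mul (rdiv (\<sigma> b) (mul v w)) (?T (\<sigma> b))
       - mul (rdiv (\<sigma> b) v) (?S (\<sigma> b)) - mul (rdiv (\<sigma> b) v) (?X (\<sigma> b)))"
    by (rule sum.reindex_bij_betw[OF bij, symmetric])
  also have "\<dots> = (\<Sum>b\<in>C. ?Z b) - (\<Sum>b\<in>C. ?Z (\<sigma> b))"
    unfolding sum_subtractf[symmetric] by (rule sum.cong) (use Z in auto)
  also have "\<dots> = 0" using sum.reindex_bij_betw[OF bij, of ?Z] by simp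
  finally show ?thesis .
qed

lemma normal_cycle_cochain [simp]: "normal (cycle_cochain gs)"
  by (simp add: cycle_cochain_def)

lemma cycle_cochain_add:
  "cycle_cochain (us @ [g + h] @ vs) = cycle_cochain (us @ [g] @ vs) + cycle_cochain (us @ [h] @ vs)"
  by (cases us) (use tail_cochain_add in \<open>simp_all add: cycle_cochain_def rdiv_add mul_add_left mul_add_right sum.distrib\<close>)

text \<open>Periodicity makes every arrow of the cycle a successor, which is the form in which the Leibniz
  rule for \<open>rdiv\<close> applies.\<close>
lemma C_image:
  assumes "N \<ge> 1" "\<And>a. a \<in> C \<Longrightarrow> (\<sigma> ^^ N) a = a" "a \<in> C"
  obtains b where "b \<in> C" "a = \<sigma> b"
proof -
  obtain m where m: "N = Suc m" using assms(1) by (cases N) auto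
  have "(\<sigma> ^^ j) a \<in> C" for j by (induction j) (use assms(3) \<sigma>_in_C in auto)
  moreover have "a = \<sigma> ((\<sigma> ^^ m) a)" using assms(2)[OF assms(3)] m by simp
  ultimately show thesis using that by blast
qed

lemma cycle_cochain_in_cocycles:
  assumes N: "N \<ge> 2" and period: "\<And>a. a \<in> C \<Longrightarrow> (\<sigma> ^^ N) a = a" and sign: "(-1 :: 'k) ^ N = 1"
  shows "cochain N cycle_cochain \<in> cocycles A E N"
proof (rule cochain_in_cocycles)
  have N1: "N \<ge> 1" using N by simp
  note pre = C_image[OF N1 period]
  {
    fix us g e h vs
    assume *: "list_all normal (us @ [g, h] @ vs)" "length (us @ [g, h] @ vs) = N" "vertex_supported e"
    show "cycle_cochain (us @ [mul g e, h] @ vs) = cycle_cochain (us @ [g, mul e h] @ vs)"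
    proof (cases us)
      case Nil
      have "mul (rdiv a (mul g e)) (tail_cochain (\<sigma> a) (h # vs)) = mul (rdiv a g) (tail_cochain (\<sigma> a) (mul e h # vs))"
        if a: "a \<in> C" for a
      proof -
        obtain b where b: "b \<in> C" "a = \<sigma> b" using pre[OF _ a] by blast
        show ?thesis using a b * Nil
          by (simp add: tail_cochain_left \<sigma>_in_C rdiv_mul_cycle mul_smul_left mul_smul_right head_C)
      qed
      then show ?thesis by (simp add: Nil cycle_cochain_def)
    next
      case (Cons u us')
      then show ?thesis using * tail_cochain_balanced[of e us' g h vs]
        by (simp add: cycle_cochain_def \<sigma>_in_C)
    qed
  next
    fix e g vs
    assume *: "list_all normal (g # vs)" "length (g # vs) = N" "vertex_supported e"
    have "rdiv a (mul e g) = mul e (rdiv a g)" if a: "a \<in> C" for a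
    proof -
      obtain b where b: "b \<in> C" "a = \<sigma> b" using pre[OF _ a] by blast
      then show ?thesis using * by (simp add: rdiv_mul_cycle)
    qed
    then show "cycle_cochain (mul e g # vs) = mul e (cycle_cochain (g # vs))"
      by (simp add: cycle_cochain_def mul_sum_right mul_assoc)
  next
    fix e g vs
    assume *: "list_all normal (vs @ [g])" "length (vs @ [g]) = N" "vertex_supported e"
    with N obtain v vs' where "vs = v # vs'" by (cases vs) auto
    then show "cycle_cochain (vs @ [mul g e]) = mul (cycle_cochain (vs @ [g])) e"
      using * tail_cochain_right[of e vs' g]
      by (simp add: cycle_cochain_def mul_sum_left mul_assoc \<sigma>_in_C)
  next
    fix gs
    assume "list_all normal gs" "length gs = Suc N"
    from cycle_cochain_cocycle[OF N period sign this]
    show "mul (hd gs) (cycle_cochain (tl gs))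
      + (\<Sum>i\<in>{1..N}. smul ((-1) ^ i) (cycle_cochain (take (i - 1) gs @ [mul (gs ! (i - 1)) (gs ! i)] @ drop (i + 1) gs)))
      + smul ((-1) ^ Suc N) (mul (cycle_cochain (butlast gs)) (last gs)) = 0"
      unfolding merge_def .
  }
qed (use N cycle_cochain_add in auto)

lemma funpow_in_C: "a \<in> C \<Longrightarrow> (\<sigma> ^^ i) a \<in> C"
  by (induction i) (auto simp: \<sigma>_in_C)

lemma acoeff_arr [simp]: "acoeff a (arr a) = 1"
  by (simp add: acoeff_def arr_def path_elem_def)

lemma tail_cochain_arrows:
  "a \<in> C \<Longrightarrow> eps (head Q ((\<sigma> ^^ m) a)) (tail_cochain a (map (\<lambda>i. arr ((\<sigma> ^^ i) a)) [0..<Suc m])) = 1"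
proof (induction m arbitrary: a)
  case 0
  then show ?case using C_arcs[of a]
    by (simp add: eps_def ldiv_apply arr_def path_elem_def)
next
  case (Suc m)
  have "map (\<lambda>i. arr ((\<sigma> ^^ i) a)) [0..<Suc (Suc m)] = arr a # map (\<lambda>i. arr ((\<sigma> ^^ i) (\<sigma> a))) [0..<Suc m]"
    by (subst upt_conv_Cons) (simp_all add: map_Suc_upt[symmetric] funpow_swap1 del: upt_Suc)
  then show ?case using Suc.IH[OF \<sigma>_in_C[OF Suc.prems]]
    by (simp add: tail_cochain_Cons eps_smul funpow_swap1 del: upt_Suc)
qed

lemma cycle_cochain_arrows:
  assumes N: "N \<ge> 2" and a: "a \<in> C" and period: "(\<sigma> ^^ N) a = a"
  shows "eps (tail Q a) (cycle_cochain (map (\<lambda>i. arr ((\<sigma> ^^ i) a)) [0..<N])) = 1"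
proof -
  obtain m where m: "N = Suc (Suc m)" using N by (auto dest!: le_Suc_ex)
  have x: "tail Q a \<in> verts Q" using C_arcs[OF a] by simp
  have l: "map (\<lambda>i. arr ((\<sigma> ^^ i) a)) [0..<N] = arr a # map (\<lambda>i. arr ((\<sigma> ^^ i) (\<sigma> a))) [0..<Suc m]"
    unfolding m by (subst upt_conv_Cons) (simp_all add: map_Suc_upt[symmetric] funpow_swap1 del: upt_Suc)
  have r: "eps (tail Q a) (rdiv b (arr a)) = (if b = a then 1 else 0)" for b
    using x by (auto simp: eps_def rdiv_apply arr_def path_elem_def)
  have "head Q ((\<sigma> ^^ m) (\<sigma> a)) = tail Q a"
    using head_C[OF funpow_in_C[OF \<sigma>_in_C[OF a], of m]] period unfolding m by (simp add: funpow_swap1)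
  with tail_cochain_arrows[OF \<sigma>_in_C[OF a], of m]
  have t: "eps (tail Q a) (tail_cochain (\<sigma> a) (map (\<lambda>i. arr ((\<sigma> ^^ i) (\<sigma> a))) [0..<Suc m])) = 1" by simp
  show ?thesis
    unfolding l cycle_cochain_def using a finite_C t
    by (simp add: eps_sum eps_mul[OF x] r if_distrib[of "\<lambda>y. y * _"] sum.delta cong: if_cong del: upt_Suc)
qed

section \<open>Gentle loops in characteristic two\<close>

definition vtx :: "'v \<Rightarrow> ('v, 'e) qpath \<Rightarrow> 'k" where
  "vtx x = path_elem (x, [])"

text \<open>The sum over all deletions of one occurrence of the loop \<open>a\<close>, a derivation in
  characteristic two. An occurrence
  inside a longer path, \<open>\<dots> c a b \<dots>\<close>, leaves the path \<open>\<dots> c b \<dots>\<close>, which is zero because \<open>a\<close> is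
  already the only nonzero continuation of \<open>c\<close>. So only initial and final occurrences count, and
  the last term corrects for the path \<open>a\<close>, whose single occurrence is both.\<close>
definition loop_cochain :: "'e \<Rightarrow> (('v, 'e) qpath \<Rightarrow> 'k) list \<Rightarrow> ('v, 'e) qpath \<Rightarrow> 'k" where
  "loop_cochain a gs = ldiv a (hd gs) + rdiv a (hd gs) - smul (acoeff a (hd gs)) (vtx (tail Q a))"

lemma vertex_supported_vtx [simp]: "x \<in> verts Q \<Longrightarrow> vertex_supported (vtx x)"
  by (auto simp: vertex_supported_def normal_def vtx_def path_elem_def)

lemma vtx_apply: "vtx x (u, p) = (if u = x \<and> p = [] then 1 else 0)"
  and arr_apply: "arr a (u, p) = (if u = tail Q a \<and> p = [a] then 1 else 0)"
  by (simp_all add: vtx_def arr_def path_elem_def)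

lemma rdiv_target: "normal g \<Longrightarrow> rdiv a g (u, p) \<noteq> 0 \<Longrightarrow> awlast u p = tail Q a"
  by (metis good_snoc normal_def rdiv_apply)

lemma vtx_mul: "x \<in> verts Q \<Longrightarrow> good (u, p) \<Longrightarrow> mul (vtx x) h (u, p) = (if u = x then h (u, p) else 0)"
  and mul_vtx: "x \<in> verts Q \<Longrightarrow> good (u, p) \<Longrightarrow> mul h (vtx x) (u, p) = (if awlast u p = x then h (u, p) else 0)"
  by (simp_all add: mul_vertex_left mul_vertex_right) (simp_all add: vtx_apply)

text \<open>By the string condition, if \<open>c a\<close> is nonzero then \<open>c b\<close> is zero for every \<open>b \<noteq> a\<close>.\<close>
lemma mul_eq_zeroI:
  assumes Y: "\<And>u p. good (u, p) \<Longrightarrow> Y (u, p) \<noteq> 0 \<Longrightarrow> p \<noteq> [] \<and> arrows_notin Q I (last p) a"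
    and Z: "\<And>u p. good (u, p) \<Longrightarrow> Z (u, p) \<noteq> 0 \<Longrightarrow> p \<noteq> [] \<and> u = tail Q a \<and> hd p \<noteq> a"
  shows "mul Y Z = 0"
proof (rule normal_eqI)
  fix u p assume g: "good (u, p)"
  have "Y (u, take i p) * Z (awlast u (take i p), drop i p) = 0" for i
  proof (rule ccontr)
    assume "Y (u, take i p) * Z (awlast u (take i p), drop i p) \<noteq> 0"
    then have y: "take i p \<noteq> []" "arrows_notin Q I (last (take i p)) a"
      and z: "drop i p \<noteq> []" "awlast u (take i p) = tail Q a" "hd (drop i p) \<noteq> a"
      using Y[OF good_take[OF g], of i] Z[OF good_drop[OF g], of i] by auto
    have "\<not> arrows_in Q I (last (take i p)) (hd (drop i p))"
      using g y(1) z(1) good_append[of u "take i p" "drop i p"] by simp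
    moreover have "hd (drop i p) \<in> arcs Q" "tail Q (hd (drop i p)) = tail Q a"
      using good_drop[OF g, of i] z by (cases "drop i p"; simp add: good_Cons)+
    ultimately have "arrows_notin Q I (last (take i p)) (hd (drop i p))"
      using y(2) by (auto simp: arrows_notin_def arrows_in_def)
    from unique_continuation[OF this y(2)] z(3) show False by simp
  qed
  then show "mul Y Z (u, p) = 0 (u, p)"
    unfolding mul_apply pointwise by (metis (mono_tags, lifting) sum.neutral)
qed auto

context
  fixes a
  assumes loop: "a \<in> C" "\<sigma> a = a"
begin

lemma loop_vertex: "head Q a = tail Q a" "tail Q a \<in> verts Q" "a \<in> arcs Q"
  using head_C[OF loop(1)] loop C_arcs[OF loop(1)] by auto

lemma ldiv_mul_loop:
  assumes "normal g" "normal h"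
  shows "ldiv a (mul g h) = mul (ldiv a g) h + smul (eps (tail Q a) g) (ldiv a h)
      - smul (acoeff a g) (mul (arr a) (ldiv a h))"
  using ldiv_mul_cycle[OF loop(1) assms] by (simp add: loop)

lemma rdiv_mul_loop:
  assumes "normal g" "normal h"
  shows "rdiv a (mul g h) = mul g (rdiv a h) + smul (eps (tail Q a) h) (rdiv a g)
      - smul (acoeff a h) (mul (rdiv a g) (arr a))"
  using rdiv_mul_cycle[OF loop(1) assms] by (simp add: loop loop_vertex)

lemma acoeff_mul_loop:
  "acoeff a (mul g h) = eps (tail Q a) g * acoeff a h + acoeff a g * eps (tail Q a) h"
  using acoeff_mul_cycle[OF loop(1)] by (simp add: loop_vertex)

lemma vtx_mul_ldiv: "mul (vtx (tail Q a)) (ldiv a h) = ldiv a h"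
  and mul_rdiv_vtx: "normal g \<Longrightarrow> mul (rdiv a g) (vtx (tail Q a)) = rdiv a g"
  and vtx_mul_arr: "mul (vtx (tail Q a)) (arr a) = arr a"
  and arr_mul_vtx: "mul (arr a) (vtx (tail Q a)) = arr a"
  and vtx_mul_vtx: "mul (vtx (tail Q a)) (vtx (tail Q a)) = vtx (tail Q a)"
proof -
  show "mul (vtx (tail Q a)) (ldiv a h) = ldiv a h"
    by (rule normal_eqI) (auto simp: vtx_mul loop_vertex ldiv_apply)
  show "mul (rdiv a g) (vtx (tail Q a)) = rdiv a g" if "normal g"
    by (rule normal_eqI) (use rdiv_target[OF that] in \<open>auto simp: mul_vtx loop_vertex\<close>)
  show "mul (vtx (tail Q a)) (arr a) = arr a" "mul (arr a) (vtx (tail Q a)) = arr a"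
    by (rule normal_eqI; auto simp: vtx_mul mul_vtx loop_vertex arr_apply)+
  show "mul (vtx (tail Q a)) (vtx (tail Q a)) = vtx (tail Q a)"
    by (rule normal_eqI) (auto simp: vtx_mul loop_vertex vtx_apply)
qed

text \<open>The Leibniz rules give the derivation property up to products such as \<open>g (a \ h)\<close>. In such a
  product a factor is split into its vertex component, the paths that meet the other factor in
  \<open>a\<close>, and the rest; the rest contributes nothing by \<open>mul_eq_zeroI\<close>. Both splittings
  leave the same term \<open>(g / a) a (a \ h)\<close>, so it occurs twice and vanishes in characteristic two.\<close>
lemma loop_cochain_mul:
  assumes char2: "(-1 :: 'k) = 1" and g: "normal g" and h: "normal h"
  shows "loop_cochain a [mul g h] = mul (loop_cochain a [g]) h + mul g (loop_cochain a [h])"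
proof -
  let ?x = "tail Q a"
  let ?e = "vtx ?x"
  have in_a: "arrows_in Q I a b \<longleftrightarrow> b = a" "arrows_in Q I b a \<longleftrightarrow> b = a" for b
    using successor[OF loop(1)] predecessor[OF loop(1)] loop(2) by auto
  have notin: "arrows_notin Q I (last p) a" if "good (u, p)" "p \<noteq> []" "awlast u p = ?x" "last p \<noteq> a" for u p
    using that in_a(2)[of "last p"] loop_vertex
    by (cases p rule: rev_cases) (auto simp: arrows_notin_def arrows_in_def good_snoc)
  note [simp] = loop_vertex
  have 1: "mul (mul g ?e - smul (eps ?x g) ?e - mul (rdiv a g) (arr a)) (ldiv a h - smul (acoeff a h) ?e) = 0"
  proof (rule mul_eq_zeroI)
    fix u p assume p: "good (u, p)"
    show "p \<noteq> [] \<and> arrows_notin Q I (last p) a"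
      if nz: "(mul g ?e - smul (eps ?x g) ?e - mul (rdiv a g) (arr a)) (u, p) \<noteq> 0"
    proof (cases p rule: rev_cases)
      case Nil
      with nz p show ?thesis
        by (auto simp: pointwise mul_vtx mul_arr_right eps_def vtx_apply split: if_splits)
    next
      case (snoc q b)
      have "b \<noteq> a \<and> head Q b = ?x"
        using nz p snoc
        by (auto simp: pointwise mul_vtx mul_arr_right vtx_apply rdiv_apply good_snoc split: if_splits)
      then show ?thesis using notin[OF p] snoc by auto
    qed
    show "p \<noteq> [] \<and> u = ?x \<and> hd p \<noteq> a" if nz: "(ldiv a h - smul (acoeff a h) ?e) (u, p) \<noteq> 0"
    proof (cases p)
      case Nil
      with nz p show ?thesis
        by (auto simp: pointwise ldiv_apply acoeff_def vtx_apply split: if_splits)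
    next
      case (Cons b q)
      with nz p have "u = ?x" "h (?x, a # p) \<noteq> 0"
        by (auto simp: pointwise ldiv_apply vtx_apply split: if_splits)
      then have "good (?x, a # p)" using h by (auto simp: normal_def)
      then show ?thesis using Cons \<open>u = ?x\<close> in_a by (auto simp: good_Cons)
    qed
  qed
  have 2: "mul (rdiv a g - smul (acoeff a g) ?e) (mul ?e h - smul (eps ?x h) ?e - mul (arr a) (ldiv a h)) = 0"
  proof (rule mul_eq_zeroI)
    fix u p assume p: "good (u, p)"
    show "p \<noteq> [] \<and> arrows_notin Q I (last p) a" if nz: "(rdiv a g - smul (acoeff a g) ?e) (u, p) \<noteq> 0"
    proof (cases p rule: rev_cases)
      case Nil
      have "g (u, [a]) = 0" if "u \<noteq> ?x" using that g by (auto simp: normal_def good_Cons)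
      with nz p Nil show ?thesis
        by (auto simp: pointwise rdiv_apply acoeff_def vtx_apply split: if_splits)
    next
      case (snoc q b)
      with nz p have "g (u, p @ [a]) \<noteq> 0"
        by (auto simp: pointwise rdiv_apply vtx_apply split: if_splits)
      then have "good (u, p @ [a])" using g by (auto simp: normal_def)
      then show ?thesis using snoc in_a notin[OF p] good_snoc[of u "q @ [b]" a] by auto
    qed
    show "p \<noteq> [] \<and> u = ?x \<and> hd p \<noteq> a"
      if nz: "(mul ?e h - smul (eps ?x h) ?e - mul (arr a) (ldiv a h)) (u, p) \<noteq> 0"
    proof (cases p)
      case Nil
      with nz p show ?thesis
        by (auto simp: pointwise vtx_mul mul_arr_left eps_def vtx_apply split: if_splits)
    next
      case (Cons b q)
      then show ?thesis
        using nz p by (auto simp: pointwise vtx_mul mul_arr_left vtx_apply ldiv_apply good_Cons split: if_splits)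
    qed
  qed
  have assoc: "mul (mul g ?e) (ldiv a h) = mul g (ldiv a h)" "mul (rdiv a g) (mul ?e h) = mul (rdiv a g) h"
    "mul (mul g ?e) ?e = mul g ?e" "mul ?e (mul ?e h) = mul ?e h"
    "mul (mul (rdiv a g) (arr a)) ?e = mul (rdiv a g) (arr a)"
    "mul ?e (mul (arr a) (ldiv a h)) = mul (arr a) (ldiv a h)"
    using mul_rdiv_vtx[OF g]
    by (simp_all add: mul_assoc vtx_mul_ldiv arr_mul_vtx vtx_mul_vtx)
      (simp_all add: mul_assoc[symmetric] vtx_mul_arr vtx_mul_vtx)
  let ?r = "mul (mul (rdiv a g) (arr a)) (ldiv a h)"
  have two: "(2 :: 'k) = 0" using char2 by (metis add.right_inverse one_add_one)
  note bilin = mul_diff_left mul_diff_right mul_add_left mul_add_right mul_smul_left mul_smul_right smul_diff smul_add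
  have "mul g (ldiv a h) - smul (eps ?x g) (ldiv a h) - ?r
      - smul (acoeff a h) (mul g ?e) + smul (acoeff a h * eps ?x g) ?e + smul (acoeff a h) (mul (rdiv a g) (arr a)) = 0"
    using 1 by (simp add: bilin assoc vtx_mul_ldiv vtx_mul_vtx algebra_simps)
  then have split_ldiv: "mul g (ldiv a h) = smul (eps ?x g) (ldiv a h) + ?r
      + smul (acoeff a h) (mul g ?e) - smul (acoeff a h * eps ?x g) ?e - smul (acoeff a h) (mul (rdiv a g) (arr a))"
    by (simp add: fun_eq_iff pointwise algebra_simps)
  have "mul (rdiv a g) h - smul (eps ?x h) (rdiv a g) - ?r
      - smul (acoeff a g) (mul ?e h) + smul (acoeff a g * eps ?x h) ?e + smul (acoeff a g) (mul (arr a) (ldiv a h)) = 0"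
    using 2 by (simp add: bilin assoc mul_rdiv_vtx[OF g] vtx_mul_vtx mul_assoc algebra_simps)
  then have split_rdiv: "mul (rdiv a g) h = smul (eps ?x h) (rdiv a g) + ?r
      + smul (acoeff a g) (mul ?e h) - smul (acoeff a g * eps ?x h) ?e - smul (acoeff a g) (mul (arr a) (ldiv a h))"
    by (simp add: fun_eq_iff pointwise algebra_simps)
  have "mul (loop_cochain a [g]) h + mul g (loop_cochain a [h]) - loop_cochain a [mul g h] = ?r + ?r"
    by (simp add: split_ldiv split_rdiv loop_cochain_def bilin ldiv_mul_loop[OF g h] rdiv_mul_loop[OF g h] acoeff_mul_loop
        smul_add_scalar fun_eq_iff pointwise algebra_simps)
  also have "?r + ?r = 0" by (simp add: fun_eq_iff pointwise two)
  finally show ?thesis by simp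
qed

lemma loop_cochain_in_cocycles:
  assumes char2: "(-1 :: 'k) = 1"
  shows "cochain 1 (loop_cochain a) \<in> cocycles A E 1"
proof (rule cochain_in_cocycles)
  let ?x = "tail Q a"
  note [simp] = loop_vertex
  {
    fix gs :: "(('v, 'e) qpath \<Rightarrow> 'k) list"
    show "normal (loop_cochain a gs)" by (simp add: loop_cochain_def)
  next
    fix us g h and vs :: "(('v, 'e) qpath \<Rightarrow> 'k) list"
    assume "length (us @ [g] @ vs) = 1"
    then show "loop_cochain a (us @ [g + h] @ vs) = loop_cochain a (us @ [g] @ vs) + loop_cochain a (us @ [h] @ vs)"
      by (simp add: loop_cochain_def ldiv_add rdiv_add acoeff_add smul_add_scalar)
  next
    fix e g vs
    assume *: "list_all normal (g # vs)" "vertex_supported e"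
    then have "smul (eps ?x e) (ldiv a g) = mul e (ldiv a g)" "smul (eps ?x e) (vtx ?x) = mul e (vtx ?x)"
      by (auto intro!: normal_eqI simp: mul_vertex_left pointwise ldiv_apply eps_def vtx_apply)
    moreover from * have "ldiv a (mul e g) = smul (eps ?x e) (ldiv a g)" "rdiv a (mul e g) = mul e (rdiv a g)"
      "acoeff a (mul e g) = acoeff a g * eps ?x e"
      by (simp_all add: ldiv_mul_loop rdiv_mul_loop acoeff_mul_loop)
    ultimately show "loop_cochain a (mul e g # vs) = mul e (loop_cochain a (g # vs))"
      by (simp add: loop_cochain_def mul_diff_right mul_add_right mul_smul_right flip: smul_smul)
  next
    fix e g vs
    assume *: "list_all normal (vs @ [g])" "length (vs @ [g]) = 1" "vertex_supported e"
    then have [simp]: "vs = []" "normal g" by auto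
    have "awlast u p = ?x" if "rdiv a g (u, p) \<noteq> 0" for u p
      using rdiv_target[OF _ that] by simp
    then have "smul (eps ?x e) (rdiv a g) = mul (rdiv a g) e" "smul (eps ?x e) (vtx ?x) = mul (vtx ?x) e"
      using *(3) by (auto intro!: normal_eqI simp: mul_vertex_right pointwise eps_def vtx_apply)
        (metis mult_zero_left)
    moreover from * have "ldiv a (mul g e) = mul (ldiv a g) e" "rdiv a (mul g e) = smul (eps ?x e) (rdiv a g)"
      "acoeff a (mul g e) = acoeff a g * eps ?x e"
      by (simp_all add: ldiv_mul_loop rdiv_mul_loop acoeff_mul_loop)
    ultimately show "loop_cochain a (vs @ [mul g e]) = mul (loop_cochain a (vs @ [g])) e"
      by (simp add: loop_cochain_def mul_diff_left mul_add_left mul_smul_left flip: smul_smul)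
  next
    fix gs
    assume *: "list_all normal gs" "length gs = Suc 1"
    then obtain g h where gs: "gs = [g, h]" by (auto simp: length_Suc_conv)
    with * loop_cochain_mul[OF char2, of g h]
    show "mul (hd gs) (loop_cochain a (tl gs))
      + (\<Sum>i\<in>{1..1}. smul ((-1) ^ i) (loop_cochain a (take (i - 1) gs @ [mul (gs ! (i - 1)) (gs ! i)] @ drop (i + 1) gs)))
      + smul ((-1) ^ Suc 1) (mul (loop_cochain a (butlast gs)) (last gs)) = 0"
      by (simp add: smul_minus_scalar)
  }
qed auto

lemma loop_cochain_arrow: "eps (tail Q a) (loop_cochain a [arr a]) = 1"
  using loop_vertex
  by (simp add: loop_cochain_def eps_def pointwise ldiv_apply rdiv_apply arr_apply vtx_apply acoeff_def)

end

section \<open>Cup products along a gentle cycle\<close>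

text \<open>In degree one the same entry is the first and the last of the tuple, and \<open>cycle_cochain\<close>
  does not make sense; the condition on the sign then says that the characteristic is two, so that
  \<open>loop_cochain\<close> takes over.\<close>
lemma cycle_cocycle_exists:
  assumes N: "N \<ge> 1" and period: "\<And>a. a \<in> C \<Longrightarrow> (\<sigma> ^^ N) a = a" and sign: "(-1 :: 'k) ^ N = 1"
    and a: "a \<in> C"
  shows "\<exists>f \<in> cocycles A E N. eps (tail Q a) (nf (f (map (\<lambda>i. cl (arr ((\<sigma> ^^ i) a))) [0..<N]))) = 1"
proof -
  have t: "map (\<lambda>i. cl (arr ((\<sigma> ^^ i) a))) [0..<N] \<in> tuples A N"
    using funpow_in_C[OF a] C_arcs by (auto simp: tuples_def)
  have m: "map nf (map (\<lambda>i. cl (arr ((\<sigma> ^^ i) a))) [0..<N]) = map (\<lambda>i. arr ((\<sigma> ^^ i) a)) [0..<N]"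
    using funpow_in_C[OF a] C_arcs by simp
  show ?thesis
  proof (cases "N = 1")
    case True
    then have l: "\<sigma> a = a" using period[OF a] by simp
    have "cochain 1 (loop_cochain a) \<in> cocycles A E 1"
      using loop_cochain_in_cocycles[OF a l] sign True by simp
    moreover have "normal (loop_cochain a [arr a])"
      using C_arcs[OF a] by (simp add: loop_cochain_def)
    ultimately show ?thesis using t m True loop_cochain_arrow[OF a l]
      by (intro bexI[of _ "cochain 1 (loop_cochain a)"]) (simp_all add: cochain_def)
  next
    case False
    with N have N2: "N \<ge> 2" by simp
    show ?thesis
      using cycle_cochain_in_cocycles[OF N2 period sign] cycle_cochain_arrows[OF N2 a period[OF a]] t
      by (intro bexI[of _ "cochain N cycle_cochain"]) (simp_all add: cochain_def m del: map_map)
  qed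
qed

lemma relation_product_zero:
  assumes a: "a \<in> C"
  shows "cl (arr a) \<otimes>\<^bsub>A\<^esub> cl (arr (\<sigma> a)) = \<zero>\<^bsub>A\<^esub>"
proof -
  have arcs: "a \<in> arcs Q" "\<sigma> a \<in> arcs Q" using a \<sigma>_in_C C_arcs by auto
  have "mul (arr a) (arr (\<sigma> a)) = 0"
  proof (rule normal_eqI)
    fix u p assume p: "good (u, p)"
    have False if "p \<noteq> []" "hd p = a" "tl p = [\<sigma> a]"
    proof -
      have "p = [a, \<sigma> a]" using that by (cases p) auto
      then show False using p successor[OF a] by (simp add: good_Cons)
    qed
    then show "mul (arr a) (arr (\<sigma> a)) (u, p) = 0 (u, p)"
      using p by (auto simp: mul_arr_left pointwise arr_apply)
  qed auto
  then show ?thesis using arcs by (intro A_eqI) auto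
qed

lemma cup_nonzero_cycle:
  assumes nm: "n \<ge> 1" "m \<ge> 1"
    and period: "\<And>a. a \<in> C \<Longrightarrow> (\<sigma> ^^ n) a = a" "\<And>a. a \<in> C \<Longrightarrow> (\<sigma> ^^ m) a = a"
    and sign: "(-1 :: 'k) ^ n = 1" "(-1 :: 'k) ^ m = 1"
    and a: "a \<in> C"
  shows "cup_nonzero A E n m"
proof -
  obtain f where f: "f \<in> cocycles A E n"
      "eps (tail Q a) (nf (f (map (\<lambda>i. cl (arr ((\<sigma> ^^ i) a))) [0..<n]))) = 1"
    using cycle_cocycle_exists[OF nm(1) _ sign(1) a] period(1) by blast
  obtain g where g: "g \<in> cocycles A E m"
      "eps (tail Q a) (nf (g (map (\<lambda>i. cl (arr ((\<sigma> ^^ i) a))) [0..<m]))) = 1"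
    using cycle_cocycle_exists[OF nm(2) _ sign(2) a] period(2) by blast
  let ?ts = "map (\<lambda>i. cl (arr ((\<sigma> ^^ i) a))) [0..<n + m]"
  have arcs: "(\<sigma> ^^ i) a \<in> arcs Q" for i using funpow_in_C[OF a] C_arcs by blast
  have tk: "take n ?ts = map (\<lambda>i. cl (arr ((\<sigma> ^^ i) a))) [0..<n]"
    by (simp add: take_map)
  have dr: "drop n ?ts = map (\<lambda>i. cl (arr ((\<sigma> ^^ i) a))) [0..<m]"
  proof (rule nth_equalityI)
    fix i assume "i < length (drop n ?ts)"
    moreover have "(\<sigma> ^^ (n + i)) a = (\<sigma> ^^ i) a"
      using period(1)[OF a] by (subst add.commute) (simp add: funpow_add)
    ultimately show "drop n ?ts ! i = map (\<lambda>i. cl (arr ((\<sigma> ^^ i) a))) [0..<m] ! i"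
      by simp
  qed simp
  show ?thesis
  proof (rule cup_nonzeroI[OF f(1) g(1) nm, of ?ts "tail Q a"])
    show "?ts \<in> tuples A (n + m)" using arcs by (auto simp: tuples_def)
    show "tail Q a \<in> verts Q" using C_arcs[OF a] by simp
    show "?ts ! i \<otimes>\<^bsub>A\<^esub> ?ts ! Suc i = \<zero>\<^bsub>A\<^esub>" if "Suc i < n + m" for i
      using relation_product_zero[OF funpow_in_C[OF a, of i]] that by (simp del: upt_Suc)
    show "eps (tail Q a) (nf t) = 0" if "t \<in> set ?ts" for t
      using that arcs by (auto simp: eps_def arr_apply)
  qed (use f(2) g(2) in \<open>simp_all only: tk dr, simp_all\<close>)
qed

end

section \<open>From gentle pairs to gentle cycles\<close>

lemma rotate1_back: "xs \<noteq> [] \<Longrightarrow> last (rotate1 xs) # butlast (rotate1 xs) = xs"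
  by (cases xs) auto

text \<open>\<open>tau\<close> rotates a cycle to the right, while \<open>rotate\<close> on lists rotates to the left.\<close>
lemma tau_funpow:
  assumes "p \<noteq> []" "j \<le> length p"
  shows "snd (fst ((tau Q ^^ j) ((u, p), (u, [])))) = rotate (length p - j) p"
  using assms(2)
proof (induction j)
  case (Suc j)
  have "length p - j = Suc (length p - Suc j)" using Suc.prems by simp
  then have "rotate (length p - j) p = rotate1 (rotate (length p - Suc j) p)" by simp
  then show ?case
    using Suc assms(1) rotate1_back[of "rotate (length p - Suc j) p"] by (simp add: tau_def Let_def)
qed simp

text \<open>Some rotation of the cycle ends in \<open>p ! i\<close> and starts with the next arrow, and the condition on
  gentle pairs concerns precisely these two arrows of each rotation.\<close>
lemma gentle_pair_neighbours:
  assumes w: "((u, p), (u, [])) \<in> gentle_pairs Q I n" and i: "i < n"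
  shows "arrows_in Q I (p ! i) b \<longleftrightarrow> b = p ! (Suc i mod n)"
    and "arrows_in Q I c (p ! (Suc i mod n)) \<longleftrightarrow> c = p ! i"
proof -
  have p: "length p = n" "p \<noteq> []" using w i by (auto simp: gentle_pairs_def cycle_pairs_def)
  let ?w = "(tau Q ^^ (n - Suc i)) ((u, p), (u, []))"
  have "tau_pow Q I n (int (n - Suc i)) ((u, p), (u, [])) \<in> cycle_pairs0 Q I n"
    using w unfolding gentle_pairs_def by blast
  then have w0: "?w \<in> cycle_pairs0 Q I n" by (simp add: tau_pow_def)
  have q: "snd (fst ?w) = rotate (Suc i) p"
    using tau_funpow[OF p(2), of "n - Suc i" Q u] p(1) i by simp
  have h: "hd (rotate (Suc i) p) = p ! (Suc i mod n)"
    using hd_rotate_conv_nth[OF p(2), of "Suc i"] p(1) by simp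
  have "hd (rotate i p) = p ! i" using hd_rotate_conv_nth[OF p(2), of i] p(1) i by simp
  then have l: "last (rotate (Suc i) p) = p ! i"
    using p(2) by (cases "rotate i p") auto
  have "arrows_in Q I (p ! i) (p ! (Suc i mod n))"
    using w0 q h l by (auto simp: cycle_pairs0_def cycle_pairs_def simp del: rotate_Suc)
  moreover have "(\<forall>c. arrows_in Q I c (p ! (Suc i mod n)) \<longrightarrow> c = p ! i)"
    "(\<forall>b. arrows_in Q I (p ! i) b \<longrightarrow> b = p ! (Suc i mod n))"
    using w0 q h l by (auto simp: cycle_pairs0_def Let_def simp del: rotate_Suc)
  ultimately show "arrows_in Q I (p ! i) b \<longleftrightarrow> b = p ! (Suc i mod n)"
    "arrows_in Q I c (p ! (Suc i mod n)) \<longleftrightarrow> c = p ! i" by blast+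
qed

lemma gentle_pairs_cycle:
  assumes qs: "quadratic_string Q I" and w: "w \<in> gentle_pairs Q I n"
  obtains P C \<sigma> a where "gentle_cycle Q I P C \<sigma>" "a \<in> C" "\<And>b. b \<in> C \<Longrightarrow> (\<sigma> ^^ n) b = b"
proof -
  obtain u p where wp: "w = ((u, p), (u, []))" and p: "length p = n" "n \<ge> 1"
    using w by (auto simp: gentle_pairs_def cycle_pairs_def)
  note nb = gentle_pair_neighbours[OF w[unfolded wp]]
  have string: "\<forall>a\<in>arcs Q. card {b. arrows_notin Q I a b} \<le> 1" and fin: "finite (arcs Q)"
    using qs unfolding quadratic_string_def by (blast intro: fin_digraph.finite_arcs)+
  obtain P where P: "P \<subseteq> {x \<in> qpaths Q. length (snd x) = 2}"
    "I = Idl\<^bsub>path_algebra Q\<^esub> (path_elem ` P)"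
    using qs by (auto simp: quadratic_string_def)
  define \<sigma> where "\<sigma> = (\<lambda>a. THE b. arrows_in Q I a b)"
  have \<sigma>: "\<sigma> (p ! i) = p ! (Suc i mod n)" if "i < n" for i
    unfolding \<sigma>_def by (rule the_equality) (simp_all add: nb(1)[OF that])
  have pow: "(\<sigma> ^^ j) (p ! i) = p ! ((i + j) mod n)" if "i < n" for i j
    using that p(2) by (induction j) (simp_all add: \<sigma> mod_Suc_eq)
  have set: "\<exists>i<n. a = p ! i" if "a \<in> set p" for a
    using that p by (auto simp: in_set_conv_nth)
  have mq: "monomial_quotient Q I P"
    using qs P unfolding monomial_quotient_def monomial_quotient_axioms_def
    by (auto simp: quadratic_string_def admissible_ideal_def)
  have "gentle_cycle Q I P (set p) \<sigma>"
  proof (intro gentle_cycle.intro[OF mq] gentle_cycle_axioms.intro)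
    fix a assume "a \<in> set p"
    then obtain i where i: "i < n" "a = p ! i" using set by blast
    show "\<sigma> a \<in> set p" using i \<sigma> p by simp
    show "arrows_in Q I a b \<longleftrightarrow> b = \<sigma> a" for b using i \<sigma> nb(1) by simp
    show "arrows_in Q I c (\<sigma> a) \<longleftrightarrow> c = a" for c using i \<sigma> nb(2) by simp
  next
    fix c b b' assume c: "arrows_notin Q I c b" "arrows_notin Q I c b'"
    have "card {b. arrows_notin Q I c b} \<le> 1"
      using string c by (auto simp: arrows_notin_def)
    moreover have "finite {b. arrows_notin Q I c b}"
      by (rule finite_subset[OF _ fin]) (auto simp: arrows_notin_def)
    ultimately show "b = b'" using c by (simp add: card_le_Suc0_iff_eq)
  qed simp
  moreover have "p ! 0 \<in> set p" using p by (intro nth_mem) auto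
  moreover have "(\<sigma> ^^ n) b = b" if "b \<in> set p" for b
    using set[OF that] pow by auto
  ultimately show thesis by (rule that)
qed

theorem theorem4p8:
  fixes Q :: "('v, 'e) pre_digraph"
    and I :: "(('v, 'e) qpath \<Rightarrow> 'k :: alg_closed_field) set"
    and n :: nat
  assumes "quadratic_string Q I"
    and "n > 0"
    and "gentle_pairs Q I n \<noteq> {}"
  shows "(\<exists>a\<ge>1. \<exists>b\<ge>1. cup_nonzero (qalgebra Q I) (vertex_subring Q I) a b) \<and>
    (\<forall>s1\<ge>1. \<forall>s2\<ge>1.
      (even n \<and> CHAR('k) \<noteq> 2 \<longrightarrow>
         cup_nonzero (qalgebra Q I) (vertex_subring Q I) (s1 * n) (s2 * n)) \<and>
      (odd n \<and> CHAR('k) \<noteq> 2 \<longrightarrow>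
         cup_nonzero (qalgebra Q I) (vertex_subring Q I) (2 * s1 * n) (2 * s2 * n)) \<and>
      (CHAR('k) = 2 \<longrightarrow>
         cup_nonzero (qalgebra Q I) (vertex_subring Q I) (s1 * n) (s2 * n)))"
proof -
  obtain P C \<sigma> a where gc: "gentle_cycle Q I P C \<sigma>" and a: "a \<in> C"
    and period: "\<And>b. b \<in> C \<Longrightarrow> (\<sigma> ^^ n) b = b"
    using gentle_pairs_cycle[OF assms(1)] assms(3) by blast
  interpret gentle_cycle Q I P C \<sigma> by (rule gc)
  have nonzero: "cup_nonzero (qalgebra Q I) (vertex_subring Q I) (s * n) (t * n)"
    if "s \<ge> 1" "t \<ge> 1" "(-1 :: 'k) ^ (s * n) = 1" "(-1 :: 'k) ^ (t * n) = 1" for s t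
  proof (rule cup_nonzero_cycle[OF _ _ _ _ that(3,4) a])
    have per: "(\<sigma> ^^ (r * n)) b = b" if "b \<in> C" for r b
      using period[OF that] by (induction r) (simp_all add: funpow_add)
    show "(\<sigma> ^^ (s * n)) b = b" "(\<sigma> ^^ (t * n)) b = b" if "b \<in> C" for b
      using per[OF that] by simp_all
  qed (use that assms(2) in auto)
  have sign: "(-1 :: 'k) ^ m = 1" if "even m \<or> CHAR('k) = 2" for m
    using that
  proof
    assume "CHAR('k) = 2"
    then have "(1 :: 'k) + 1 = 0" using of_nat_CHAR[where ?'a = 'k] by simp
    then have "(-1 :: 'k) = 1" by (metis add_eq_0_iff)
    then show ?thesis by (simp only: power_one)
  qed simp
  \<comment> \<open>The degree \<open>2 n\<close> is even whatever \<open>n\<close> is.\<close>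
  have "\<exists>a\<ge>1. \<exists>b\<ge>1. cup_nonzero (qalgebra Q I) (vertex_subring Q I) a b"
    using nonzero[of 2 2] sign[of "2 * n"] assms(2) by (intro exI[of _ "2 * n"] conjI) auto
  moreover have "cup_nonzero (qalgebra Q I) (vertex_subring Q I) (s1 * n) (s2 * n)"
    if "s1 \<ge> 1" "s2 \<ge> 1" "even n \<or> CHAR('k) = 2" for s1 s2
    using that by (intro nonzero sign) auto
  moreover have "cup_nonzero (qalgebra Q I) (vertex_subring Q I) (2 * s1 * n) (2 * s2 * n)"
    if "s1 \<ge> 1" "s2 \<ge> 1" for s1 s2
    using that by (intro nonzero sign) auto
  ultimately show ?thesis by blast
qed

end
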